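(* Let $n,k,s,p$ be positive integers with $n\geq 4k^2s$, and let $\vec{p}=(p_0,p_1,\ldots,p_s)=(p,1,\ldots,1)$ (so $p_0=p$ and $p_1=\cdots=p_s=1$). Then $$f_{\vec{p}}(n,k,s)=\max\left\{s\binom{n}{k},\ (p+s)\left(\binom{n}{k}-\binom{n-s}{k}\right)\right\}.$$
   Context: $[n]=\{1,\ldots,n\}$ and $\binom{[n]}{k}$ is the collection of all $k$-element subsets of $[n]$. For families $\mathcal{A}_1,\ldots,\mathcal{A}_m\subseteq 2^{[n]}$ the rainbow matching number $\nu(\mathcal{A}_1,\ldots,\mathcal{A}_m)$ is the maximum integer $r$ such that there are indices $1\leq i_1<\cdots<i_r\leq m$ and pairwise disjoint sets $A_{i_1}\in\mathcal{A}_{i_1},\ldots,A_{i_r}\in\mathcal{A}_{i_r}$. A sequence of $s+1$ families $\mathcal{B}_0,\mathcal{B}_1,\ldots,\mathcal{B}_s\subseteq 2^{[n]}$ is called overlapping if $\nu(\mathcal{B}_0,\ldots,\mathcal{B}_s)\leq s$, i.e. one cannot choose pairwise disjoint sets $B_i\in\mathcal{B}_i$, $i=0,\ldots,s$. For real constants $p_0\geq p_1\geq\cdots\geq p_s>0$, $\vec{p}=(p_0,\ldots,p_s)$ and $n\geq (s+1)k$, define $$f_{\vec{p}}(n,k,s)=\max\left\{\sum_{i=0}^s p_i|\mathcal{B}_i| : \mathcal{B}_0\subseteq\mathcal{B}_1\subseteq\cdots\subseteq\mathcal{B}_s\subseteq\binom{[n]}{k}\text{ are overlapping}\right\}$$ (families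 may be empty and may coincide). *)

theory Defs
  imports Complex_Main "HOL-Library.Disjoint_Sets" "HOL-Library.FuncSet"
begin

definition k_subsets :: "nat \<Rightarrow> nat \<Rightarrow> nat set set" where
  "k_subsets n k = {A. A \<subseteq> {1..n} \<and> card A = k}"

(* The families are F i for i in the finite index set I; an increasing choice of r indices
   is the same thing as an r-element subset J of I. *)
definition rainbow_matching_number :: "nat set \<Rightarrow> (nat \<Rightarrow> nat set set) \<Rightarrow> nat" where
  "rainbow_matching_number I F =
     Max {card J | J. J \<subseteq> I \<and> (\<exists>A. (\<forall>i\<in>J. A i \<in> F i) \<and> disjoint_family_on A J)}"

definition overlapping :: "nat \<Rightarrow> (nat \<Rightarrow> nat set set) \<Rightarrow> bool" where
  "overlapping s B \<longleftrightarrow> rainbow_matching_number {0..s} B \<le> s"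

(* Only B 0, ..., B s matter; the values of B beyond s are unconstrained and irrelevant. *)
definition max_weight :: "(nat \<Rightarrow> real) \<Rightarrow> nat \<Rightarrow> nat \<Rightarrow> nat \<Rightarrow> real" where
  "max_weight p n k s =
     Max {(\<Sum>i=0..s. p i * real (card (B i))) | B.
            (\<forall>i<s. B i \<subseteq> B (Suc i)) \<and> B s \<subseteq> k_subsets n k \<and> overlapping s B}"

lemma rainbow_matching_sizes_finite:
  assumes "finite I"
  shows "finite {card J | J. J \<subseteq> I \<and> (\<exists>A. (\<forall>i\<in>J. A i \<in> F i) \<and> disjoint_family_on A J)}"
proof -
  have "finite (card ` Pow I)" using assms by simp
  then show ?thesis by (rule rev_finite_subset) auto
qed

lemma rainbow_matching_sizes_nonempty:
  "{card J | J. J \<subseteq> I \<and> (\<exists>A. (\<forall>i\<in>J. A i \<in> F i) \<and> disjoint_family_on A J)} \<noteq> {}"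
proof -
  have "{} \<subseteq> I \<and> (\<exists>A. (\<forall>i\<in>{}. A i \<in> F i) \<and> disjoint_family_on A {})"
    by (simp add: disjoint_family_on_def)
  then show ?thesis by blast
qed

lemma overlapping_iff:
  "overlapping s B \<longleftrightarrow> \<not> (\<exists>A. (\<forall>i\<in>{0..s}. A i \<in> B i) \<and> disjoint_family_on A {0..s})"
proof -
  let ?P = "\<lambda>J. \<exists>A. (\<forall>i\<in>J. A i \<in> B i) \<and> disjoint_family_on A J"
  have "overlapping s B \<longleftrightarrow> (\<forall>J. J \<subseteq> {0..s} \<and> ?P J \<longrightarrow> card J \<le> s)"
    unfolding overlapping_def rainbow_matching_number_def
    by (subst Max_le_iff[OF rainbow_matching_sizes_finite rainbow_matching_sizes_nonempty]) auto
  also have "\<dots> \<longleftrightarrow> \<not> ?P {0..s}"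
  proof
    assume "\<forall>J. J \<subseteq> {0..s} \<and> ?P J \<longrightarrow> card J \<le> s"
    from this[rule_format, of "{0..s}"] show "\<not> ?P {0..s}" by auto
  next
    assume no: "\<not> ?P {0..s}"
    show "\<forall>J. J \<subseteq> {0..s} \<and> ?P J \<longrightarrow> card J \<le> s"
    proof (intro allI impI)
      fix J assume J: "J \<subseteq> {0..s} \<and> ?P J"
      then have "J \<subset> {0..s}" using no by blast
      then have "card J < card {0..s}" by (intro psubset_card_mono) auto
      then show "card J \<le> s" by simp
    qed
  qed
  finally show ?thesis .
qed

lemma weights_finite:
  "finite {(\<Sum>i=0..s. p i * real (card (B i))) | B.
            (\<forall>i<s. B i \<subseteq> B (Suc i)) \<and> B s \<subseteq> k_subsets n k \<and> overlapping s B}"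
proof -
  have fin: "finite (k_subsets n k)" unfolding k_subsets_def by simp
  let ?T = "(\<lambda>B. \<Sum>i=0..s. p i * real (card (B i))) ` (PiE {0..s} (\<lambda>_. Pow (k_subsets n k)))"
  have "finite ?T" using fin by (intro finite_imageI finite_PiE) auto
  moreover have "(\<Sum>i=0..s. p i * real (card (B i))) \<in> ?T"
    if mono: "\<forall>i<s. B i \<subseteq> B (Suc i)" and sub: "B s \<subseteq> k_subsets n k" for B
  proof (rule image_eqI)
    show "(\<Sum>i=0..s. p i * real (card (B i))) = (\<Sum>i=0..s. p i * real (card (restrict B {0..s} i)))"
      by (intro sum.cong) auto
    have "B i \<subseteq> k_subsets n k" if "i \<le> s" for i
      using that by (induction rule: inc_induct) (use mono sub in auto)
    then show "restrict B {0..s} \<in> PiE {0..s} (\<lambda>_. Pow (k_subsets n k))" by auto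
  qed
  ultimately show ?thesis by (elim rev_finite_subset) blast
qed

lemma weights_nonempty:
  "{(\<Sum>i=0..s. p i * real (card (B i))) | B.
      (\<forall>i<s. B i \<subseteq> B (Suc i)) \<and> B s \<subseteq> k_subsets n k \<and> overlapping s B} \<noteq> {}"
proof -
  have "overlapping s (\<lambda>_. {})" by (auto simp: overlapping_iff)
  then have "(\<Sum>i=0..s. p i * real (card ({} :: nat set set))) \<in>
    {(\<Sum>i=0..s. p i * real (card (B i))) | B.
      (\<forall>i<s. B i \<subseteq> B (Suc i)) \<and> B s \<subseteq> k_subsets n k \<and> overlapping s B}"
    by (intro CollectI exI[of _ "\<lambda>_. {}"]) simp
  then show ?thesis by (rule ex_in_conv[THEN iffD1, OF exI])
qed

end

theory Submission
  imports Defs "HOL-Combinatorics.Permutations"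
begin

text \<open>Write \<open>m\<close> for the number of \<open>k\<close>-sets, \<open>C\<close> and \<open>c\<close> for the number of \<open>k\<close>-sets through one and
  through two given points, and \<open>E u\<close> for the number of \<open>k\<close>-sets meeting a given \<open>u\<close>-set.
  Families with more than \<open>s * k * C\<close> members can always be matched last, so if \<open>B u\<close> is the largest
  family that is not of this size, then already \<open>B 0, \<dots>, B u\<close> are overlapping; the remaining
  \<open>s - u\<close> families are bounded by \<open>m\<close> each. For the small families, let \<open>H\<close> be the set of the points whose
  degree in \<open>B 0\<close> exceeds \<open>k * s * c\<close>. Each of them can be deleted together with one family, so
  \<open>h = card H \<le> u\<close>. Among the sets avoiding \<open>H\<close>, a lemma of Huang, Loh and Sudakov shows that at most
  \<open>u - h\<close> points have degree above \<open>2 * s * c\<close>, so that \<open>B 0\<close>, which is covered by \<open>k * (u - h)\<close> points,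
  contributes too little to compete with the \<open>k\<close>-sets meeting \<open>u - h\<close> further points.
  Hence the weight of \<open>B 0, \<dots>, B u\<close> is at most \<open>(p + u) * E u\<close> as soon as \<open>p \<ge> n / k - s\<close>.
  At the critical real weight \<open>q\<close> with \<open>(q + s) * E s = s * m\<close>, one has \<open>(q + u) * E u + (s - u) * m \<le> s * m\<close>
  for all \<open>u \<le> s\<close>. Smaller \<open>p\<close> follow by monotonicity, larger \<open>p\<close> because
  the bound grows with slope \<open>E u \<le> E s\<close>.\<close>

section \<open>Rainbow matchings and stars\<close>

text \<open>Index set and index type are arbitrary because the proof passes to sub-collections of
  the families. Overlapping means that \<open>rainbow {..s} B\<close> fails.\<close>

definition rainbow :: "'i set \<Rightarrow> ('i \<Rightarrow> 'a set set) \<Rightarrow> bool" where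
  "rainbow I F \<longleftrightarrow> (\<exists>A. (\<forall>i\<in>I. A i \<in> F i) \<and> disjoint_family_on A I)"

definition subsets_of_card :: "'a set \<Rightarrow> nat \<Rightarrow> 'a set set" where
  "subsets_of_card V k = {A. A \<subseteq> V \<and> card A = k}"

text \<open>The number of \<open>k\<close>-subsets of a nonempty \<open>n\<close>-set through a
  fixed point. The value at \<open>k = 0\<close> is set apart because truncated subtraction would
  turn it into 1.\<close>

definition star_size :: "nat \<Rightarrow> nat \<Rightarrow> nat" where
  "star_size n k = (if k = 0 then 0 else (n - 1) choose (k - 1))"

lemma rainbowI: "(\<And>i. i \<in> I \<Longrightarrow> A i \<in> F i) \<Longrightarrow> disjoint_family_on A I \<Longrightarrow> rainbow I F"
  unfolding rainbow_def by blast

lemma rainbow_mono: "rainbow I F \<Longrightarrow> (\<And>i. i \<in> I \<Longrightarrow> F i \<subseteq> G i) \<Longrightarrow> rainbow I G"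
  unfolding rainbow_def by blast

lemma finite_subsets_of_card [simp]: "finite V \<Longrightarrow> finite (subsets_of_card V k)"
  unfolding subsets_of_card_def by simp

lemma card_subsets_of_card: "finite V \<Longrightarrow> card (subsets_of_card V k) = card V choose k"
  unfolding subsets_of_card_def by (rule n_subsets)

lemma star_size_absorb: "n * star_size n k = k * (n choose k)"
proof (cases "k = 0 \<or> n = 0")
  case False
  then show ?thesis
    using Suc_times_binomial_eq[of "n - 1" "k - 1"] by (simp add: star_size_def mult.commute)
qed (auto simp: star_size_def)

section \<open>Counting sets through given points\<close>

lemma card_star:
  assumes "finite V" "x \<in> V"
  shows "card {A \<in> subsets_of_card V k. x \<in> A} = star_size (card V) k"
proof (cases "k = 0")
  case True
  have "{A \<in> subsets_of_card V k. x \<in> A} = {}"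
    using True assms by (auto simp: subsets_of_card_def dest: finite_subset)
  then have "card {A \<in> subsets_of_card V k. x \<in> A} = 0" by (simp only: card.empty)
  then show ?thesis using True by (simp add: star_size_def)
next
  case False
  have "bij_betw (insert x) (subsets_of_card (V - {x}) (k - 1)) {A \<in> subsets_of_card V k. x \<in> A}"
  proof (rule bij_betwI[where g = "\<lambda>A. A - {x}"])
    show "insert x \<in> subsets_of_card (V - {x}) (k - 1) \<rightarrow> {A \<in> subsets_of_card V k. x \<in> A}"
    proof
      fix A assume "A \<in> subsets_of_card (V - {x}) (k - 1)"
      then have A: "A \<subseteq> V - {x}" "card A = k - 1" by (auto simp: subsets_of_card_def)
      then have "finite A" using assms by (meson finite_Diff finite_subset)
      then have "card (insert x A) = k" using A False by (subst card_insert_disjoint) auto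
      then show "insert x A \<in> {A \<in> subsets_of_card V k. x \<in> A}"
        using A assms by (auto simp: subsets_of_card_def)
    qed
  qed (use assms in \<open>auto simp: subsets_of_card_def\<close>)
  then have "card (subsets_of_card (V - {x}) (k - 1)) = card {A \<in> subsets_of_card V k. x \<in> A}"
    by (rule bij_betw_same_card)
  then show ?thesis using assms False by (simp add: card_subsets_of_card star_size_def)
qed

lemma card_star_pair:
  assumes "finite V" "x \<in> V" "y \<in> V" "x \<noteq> y"
  shows "card {A \<in> subsets_of_card V k. x \<in> A \<and> y \<in> A} = star_size (card V - 1) (k - 1)"
proof -
  have "bij_betw (insert x) {A \<in> subsets_of_card (V - {x}) (k - 1). y \<in> A}
      {A \<in> subsets_of_card V k. x \<in> A \<and> y \<in> A}"
  proof (rule bij_betwI[where g = "\<lambda>A. A - {x}"])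
    show "insert x \<in> {A \<in> subsets_of_card (V - {x}) (k - 1). y \<in> A}
        \<rightarrow> {A \<in> subsets_of_card V k. x \<in> A \<and> y \<in> A}"
    proof
      fix A assume "A \<in> {A \<in> subsets_of_card (V - {x}) (k - 1). y \<in> A}"
      then have A: "A \<subseteq> V - {x}" "card A = k - 1" "y \<in> A" by (auto simp: subsets_of_card_def)
      then have fin: "finite A" using assms by (meson finite_Diff finite_subset)
      then have "card A > 0" using A by (auto simp: card_gt_0_iff)
      then have "card (insert x A) = k" using A fin by (subst card_insert_disjoint) auto
      then show "insert x A \<in> {A \<in> subsets_of_card V k. x \<in> A \<and> y \<in> A}"
        using A assms by (auto simp: subsets_of_card_def)
    qed
  qed (use assms in \<open>auto simp: subsets_of_card_def\<close>)
  then have "card {A \<in> subsets_of_card (V - {x}) (k - 1). y \<in> A}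
      = card {A \<in> subsets_of_card V k. x \<in> A \<and> y \<in> A}"
    by (rule bij_betw_same_card)
  then show ?thesis using assms card_star[of "V - {x}" y "k - 1"] by simp
qed

lemma card_meeting_le_sum:
  assumes "finite F" "finite Z"
  shows "card {A \<in> F. A \<inter> Z \<noteq> {}} \<le> (\<Sum>z\<in>Z. card {A \<in> F. z \<in> A})"
proof -
  have "{A \<in> F. A \<inter> Z \<noteq> {}} = (\<Union>z\<in>Z. {A \<in> F. z \<in> A})" by blast
  then show ?thesis using card_UN_le[OF assms(2), of "\<lambda>z. {A \<in> F. z \<in> A}"] by simp
qed

lemma card_meeting_le:
  assumes "finite V" "F \<subseteq> subsets_of_card V k" "Z \<subseteq> V"
  shows "card {A \<in> F. A \<inter> Z \<noteq> {}} \<le> card Z * star_size (card V) k"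
proof -
  have "card {A \<in> F. z \<in> A} \<le> star_size (card V) k" if z: "z \<in> Z" for z
  proof -
    have "z \<in> V" using assms z by blast
    moreover have "card {A \<in> F. z \<in> A} \<le> card {A \<in> subsets_of_card V k. z \<in> A}"
      using assms by (intro card_mono) auto
    ultimately show ?thesis using card_star[OF assms(1)] by simp
  qed
  then have "(\<Sum>z\<in>Z. card {A \<in> F. z \<in> A}) \<le> card Z * star_size (card V) k"
    using sum_bounded_above[of Z "\<lambda>z. card {A \<in> F. z \<in> A}"] by simp
  then show ?thesis
    using card_meeting_le_sum[of F Z] assms by (meson finite_subset finite_subsets_of_card le_trans)
qed

lemma card_through_meeting_le:
  assumes "finite V" "F \<subseteq> subsets_of_card V k" "Z \<subseteq> V" "x \<in> V" "x \<notin> Z"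
  shows "card {A \<in> F. x \<in> A \<and> A \<inter> Z \<noteq> {}} \<le> card Z * star_size (card V - 1) (k - 1)"
proof -
  let ?F = "{A \<in> F. x \<in> A}"
  have "card {A \<in> ?F. z \<in> A} \<le> star_size (card V - 1) (k - 1)" if z: "z \<in> Z" for z
  proof -
    have "z \<in> V" "x \<noteq> z" using assms z by blast+
    moreover have "card {A \<in> ?F. z \<in> A} \<le> card {A \<in> subsets_of_card V k. x \<in> A \<and> z \<in> A}"
      using assms by (intro card_mono) auto
    ultimately show ?thesis using card_star_pair[OF assms(1,4)] by simp
  qed
  then have "(\<Sum>z\<in>Z. card {A \<in> ?F. z \<in> A}) \<le> card Z * star_size (card V - 1) (k - 1)"
    using sum_bounded_above[of Z "\<lambda>z. card {A \<in> ?F. z \<in> A}"] by simp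
  moreover have "card {A \<in> ?F. A \<inter> Z \<noteq> {}} \<le> (\<Sum>z\<in>Z. card {A \<in> ?F. z \<in> A})"
  proof (rule card_meeting_le_sum)
    show "finite ?F" using finite_subset[OF assms(2)] assms(1) by simp
    show "finite Z" using finite_subset[OF assms(3,1)] .
  qed
  ultimately have "card {A \<in> ?F. A \<inter> Z \<noteq> {}} \<le> card Z * star_size (card V - 1) (k - 1)"
    by (rule le_trans[rotated])
  also have "{A \<in> ?F. A \<inter> Z \<noteq> {}} = {A \<in> F. x \<in> A \<and> A \<inter> Z \<noteq> {}}" by blast
  finally show ?thesis .
qed

text \<open>Greedy completion: the indices in \<open>J\<close> are served last, and
  \<open>P j\<close> is a set of points kept free for \<open>j\<close>. When the turn of
  \<open>j\<close> comes, the sets already chosen and the points reserved for the rest of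
  \<open>J\<close> form a set \<open>Z\<close> of at most \<open>k * (card I - 1)\<close> points
  outside \<open>P j\<close>, and \<open>ext\<close> supplies a set avoiding
  \<open>Z\<close>.\<close>

lemma rainbow_extend:
  assumes "finite I" "J \<subseteq> I" "finite V"
    and F: "\<And>i. i \<in> I \<Longrightarrow> F i \<subseteq> subsets_of_card V k"
    and P: "\<And>j. j \<in> J \<Longrightarrow> P j \<subseteq> V \<and> card (P j) \<le> k" "disjoint_family_on P J"
    and ext: "\<And>j Z. j \<in> J \<Longrightarrow> Z \<subseteq> V \<Longrightarrow> card Z \<le> k * (card I - 1) \<Longrightarrow> Z \<inter> P j = {} \<Longrightarrow> \<exists>A\<in>F j. A \<inter> Z = {}"
    and A: "\<And>i. i \<in> I - J \<Longrightarrow> A i \<in> F i" "disjoint_family_on A (I - J)"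
      "\<And>i j. i \<in> I - J \<Longrightarrow> j \<in> J \<Longrightarrow> A i \<inter> P j = {}"
  shows "rainbow I F"
proof -
  have "finite J" using assms(1,2) finite_subset by blast
  then show ?thesis using assms(2) P ext A
  proof (induction J arbitrary: A rule: finite_induct)
    case empty
    then show ?case by (intro rainbowI[of I A F]) auto
  next
    case (insert j J)
    define Z where "Z = (\<Union>i\<in>I - insert j J. A i) \<union> (\<Union>i\<in>J. P i)"
    have AV: "A i \<subseteq> V \<and> card (A i) = k" if "i \<in> I - insert j J" for i
      using insert.prems(5)[OF that] F[of i] that by (auto simp: subsets_of_card_def)
    have "Z \<subseteq> V" using AV insert.prems(2) unfolding Z_def by blast
    have "card Z \<le> card (\<Union>i\<in>I - insert j J. A i) + card (\<Union>i\<in>J. P i)"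
      unfolding Z_def by (rule card_Un_le)
    also have "card (\<Union>i\<in>I - insert j J. A i) \<le> (\<Sum>i\<in>I - insert j J. card (A i))"
      using assms(1) by (intro card_UN_le) auto
    also have "\<dots> = card (I - insert j J) * k" using AV by simp
    also have "card (\<Union>i\<in>J. P i) \<le> (\<Sum>i\<in>J. card (P i))"
      using insert.hyps by (intro card_UN_le) auto
    also have "\<dots> \<le> card J * k" using insert.prems(2) by (intro sum_bounded_above[of _ _ k, simplified]) auto
    also have "card (I - insert j J) * k + card J * k = k * (card I - 1)"
    proof -
      have "card (I - insert j J) = card I - card (insert j J)"
        using insert.hyps insert.prems(1) by (intro card_Diff_subset) auto
      moreover have "card (insert j J) \<le> card I" using insert.prems(1) assms(1) by (intro card_mono) auto
      moreover have "card (insert j J) = Suc (card J)" using insert.hyps by simp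
      ultimately have "card (I - insert j J) + card J = card I - 1" by simp
      then show ?thesis by (metis add_mult_distrib mult.commute)
    qed
    finally have "card Z \<le> k * (card I - 1)" by simp
    moreover have "Z \<inter> P j = {}"
    proof -
      have "A i \<inter> P j = {}" if "i \<in> I - insert j J" for i
        using insert.prems(7)[OF that] by simp
      moreover have "P i \<inter> P j = {}" if "i \<in> J" for i
        using insert.hyps(2) that by (intro disjoint_family_onD[OF insert.prems(3)]) auto
      ultimately show ?thesis unfolding Z_def by blast
    qed
    ultimately obtain S where S: "S \<in> F j" "S \<inter> Z = {}"
      using insert.prems(4)[of j Z] \<open>Z \<subseteq> V\<close> by auto
    show ?case
    proof (rule insert.IH[of "A(j := S)"])
      show "disjoint_family_on (A(j := S)) (I - J)"
        using insert.prems(6) S(2) unfolding disjoint_family_on_def Z_def by (simp; blast)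
    next
      show "disjoint_family_on P J" using insert.prems(3) by (auto simp: disjoint_family_on_def)
    next
      fix i j' assume "i \<in> I - J" "j' \<in> J"
      then show "(A(j := S)) i \<inter> P j' = {}" using S(2) insert.prems(7) unfolding Z_def by auto
    qed (use insert.prems S in \<open>auto\<close>)
  qed
qed

section \<open>The Huang--Loh--Sudakov lemma\<close>

lemma ex_disjoint_blocks:
  assumes "finite I" "finite V" "(\<Sum>i\<in>I. k i) \<le> card V"
  shows "\<exists>P. (\<forall>i\<in>I. P i \<in> subsets_of_card V (k i)) \<and> disjoint_family_on P I"
  using assms
proof (induction I arbitrary: V rule: finite_induct)
  case empty
  then show ?case by (simp add: disjoint_family_on_def)
next
  case (insert i I)
  have "k i \<le> card V" using insert by simp
  then obtain B where B: "B \<subseteq> V" "card B = k i" "finite B" using obtain_subset_with_card_n by metis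
  have "sum k I \<le> card (V - B)" using insert B by (simp add: card_Diff_subset)
  then obtain P where P: "\<forall>i\<in>I. P i \<in> subsets_of_card (V - B) (k i)" "disjoint_family_on P I"
    using insert.IH[of "V - B"] insert.prems by auto
  define Q where "Q = P(i := B)"
  have Q: "Q i = B" "\<And>l. l \<in> I \<Longrightarrow> Q l = P l" using insert.hyps by (auto simp: Q_def)
  have "\<forall>l\<in>insert i I. Q l \<in> subsets_of_card V (k l)"
    using P(1) B Q by (auto simp: subsets_of_card_def)
  moreover have "disjoint_family_on Q (insert i I)"
  proof -
    have "disjoint_family_on Q I" using P(2) Q(2) by (auto simp: disjoint_family_on_def)
    moreover have "Q i \<inter> \<Union> (Q ` I) = {}" using P(1) Q by (auto simp: subsets_of_card_def)
    ultimately show ?thesis using insert.hyps by (simp add: disjoint_family_on_insert)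
  qed
  ultimately show ?case by blast
qed

section \<open>Random permutations and the case of sizes that fill the ground set\<close>

lemma ex_permutes_image:
  assumes "finite V" "P \<in> subsets_of_card V k" "Q \<in> subsets_of_card V k"
  shows "\<exists>\<pi>. \<pi> permutes V \<and> \<pi> ` P = Q"
proof -
  have PQ: "P \<subseteq> V" "Q \<subseteq> V" "card P = card Q" "finite P" "finite Q"
    using assms by (auto simp: subsets_of_card_def dest: finite_subset)
  then have "card (V - P) = card (V - Q)" using assms by (simp add: card_Diff_subset)
  then obtain f g where fg: "bij_betw f P Q" "bij_betw g (V - P) (V - Q)"
    using PQ assms by (metis finite_Diff finite_same_card_bij)
  define h where "h x = (if x \<in> P then f x else if x \<in> V then g x else x)" for x
  have "bij_betw h P Q = bij_betw f P Q" by (rule bij_betw_cong) (simp add: h_def)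
  moreover have "bij_betw h (V - P) (V - Q) = bij_betw g (V - P) (V - Q)"
    by (rule bij_betw_cong) (simp add: h_def)
  ultimately have h: "bij_betw h P Q" "bij_betw h (V - P) (V - Q)" using fg by auto
  have "bij_betw h (P \<union> (V - P)) (Q \<union> (V - Q))"
    using h by (intro bij_betw_combine) auto
  then have "bij_betw h V V" using PQ by (simp add: Un_absorb1)
  then have "h permutes V" using PQ by (intro bij_imp_permutes) (auto simp: h_def)
  then show ?thesis using h by (auto simp: bij_betw_def)
qed

text \<open>Composition with a permutation carrying \<open>P\<close> to \<open>Q\<close> shows that
  every \<open>k\<close>-set is the image of \<open>P\<close> under equally many permutations. So a
  random image of \<open>P\<close> lies in \<open>F\<close> with probability \<open>card F\<close>
  divided by the number of all \<open>k\<close>-sets.\<close>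

lemma card_permutes_image_in:
  assumes "finite V" "P \<in> subsets_of_card V k" "F \<subseteq> subsets_of_card V k"
  shows "card {\<sigma>. \<sigma> permutes V \<and> \<sigma> ` P \<in> F} * (card V choose k) = fact (card V) * card F"
proof -
  define N where "N Q = {\<sigma>. \<sigma> permutes V \<and> \<sigma> ` P = Q}" for Q
  have fin: "finite (N Q)" for Q
    unfolding N_def using finite_permutations[OF assms(1)] by (rule rev_finite_subset) auto
  have "card (N Q) = card (N P)" if Q: "Q \<in> subsets_of_card V k" for Q
  proof -
    obtain \<pi> where \<pi>: "\<pi> permutes V" "\<pi> ` P = Q" using ex_permutes_image[OF assms(1,2) Q] by auto
    have inj: "inj \<pi>" "inv \<pi> permutes V"
      using permutes_inj[OF \<pi>(1)] permutes_inv[OF \<pi>(1)] by auto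
    then have "inv \<pi> ` Q = P" using \<pi>(2) by (auto simp: image_image)
    note inj = inj this
    have "bij_betw (\<lambda>\<sigma>. \<pi> \<circ> \<sigma>) (N P) (N Q)"
    proof (rule bij_betwI[where g = "\<lambda>\<sigma>. inv \<pi> \<circ> \<sigma>"])
      have comp: "\<pi>' \<circ> \<sigma> \<in> N (\<pi>' ` R)" if "\<pi>' permutes V" "\<sigma> \<in> N R" for \<pi>' \<sigma> R
        using that permutes_compose[of \<sigma> V \<pi>'] image_comp[of \<pi>' \<sigma> P] by (auto simp: N_def)
      show "(\<lambda>\<sigma>. \<pi> \<circ> \<sigma>) \<in> N P \<rightarrow> N Q" using comp[OF \<pi>(1)] \<pi>(2) by blast
      show "(\<lambda>\<sigma>. inv \<pi> \<circ> \<sigma>) \<in> N Q \<rightarrow> N P" using comp[OF inj(2)] inj(3) by blast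
    next
      fix \<sigma>
      show "inv \<pi> \<circ> (\<pi> \<circ> \<sigma>) = \<sigma>" using inj by (simp add: fun_eq_iff)
      show "\<pi> \<circ> (inv \<pi> \<circ> \<sigma>) = \<sigma>" using \<pi> by (simp add: fun_eq_iff permutes_inverses)
    qed
    then show ?thesis using bij_betw_same_card by metis
  qed
  then have const: "card {\<sigma>. \<sigma> permutes V \<and> \<sigma> ` P \<in> G} = card G * card (N P)"
    if G: "G \<subseteq> subsets_of_card V k" for G
  proof -
    have "{\<sigma>. \<sigma> permutes V \<and> \<sigma> ` P \<in> G} = (\<Union>Q\<in>G. N Q)" by (auto simp: N_def)
    also have "card \<dots> = (\<Sum>Q\<in>G. card (N Q))"
      using fin G assms(1) by (intro card_UN_disjoint) (auto simp: N_def intro: finite_subset)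
    also have "\<dots> = (\<Sum>Q\<in>G. card (N P))"
      using G \<open>\<And>Q. Q \<in> subsets_of_card V k \<Longrightarrow> card (N Q) = card (N P)\<close> by (intro sum.cong) auto
    finally show ?thesis by simp
  qed
  have "\<sigma> ` P \<in> subsets_of_card V k" if "\<sigma> permutes V" for \<sigma>
  proof -
    have "\<sigma> ` P \<subseteq> V"
      using assms(2) permutes_image[OF that] by (auto simp: subsets_of_card_def)
    moreover have "card (\<sigma> ` P) = card P"
      using permutes_inj[OF that] by (auto intro: card_image inj_on_subset)
    ultimately show ?thesis using assms(2) by (simp add: subsets_of_card_def)
  qed
  then have "{\<sigma>. \<sigma> permutes V \<and> \<sigma> ` P \<in> subsets_of_card V k} = {\<sigma>. \<sigma> permutes V}" by auto
  \<comment> \<open>The family of all \<open>k\<close>-sets accounts for every permutation, which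
    determines the common number \<open>card (N P)\<close>.\<close>
  then have "fact (card V) = (card V choose k) * card (N P)"
    using const[of "subsets_of_card V k"] card_permutations[OF refl assms(1)]
      card_subsets_of_card[OF assms(1)] by simp
  then show ?thesis using const[OF assms(3)] by simp
qed

text \<open>A union bound over random permutations of disjoint blocks \<open>P i\<close>. With
  \<open>r\<close> for \<open>card I\<close> and \<open>n\<close> for \<open>card V\<close>, block
  \<open>i\<close> misses \<open>F i\<close> with probability below
  \<open>1 - (r - 1) * k i / n\<close>. As the blocks fill \<open>V\<close>, these bounds add up to
  \<open>r - (r - 1) = 1\<close>.\<close>

lemma rainbow_exact:
  assumes I: "finite I" and V: "finite V"
    and F: "\<And>i. i \<in> I \<Longrightarrow> F i \<subseteq> subsets_of_card V (k i)"
    and sum: "(\<Sum>i\<in>I. k i) = card V"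
    and large: "\<And>i. i \<in> I \<Longrightarrow> card (F i) > (card I - 1) * star_size (card V) (k i)"
  shows "rainbow I F"
proof (cases "I = {} \<or> card V = 0")
  case True
  show ?thesis
  proof (cases "I = {}")
    case False
    then have "V = {}" using True V by simp
    then have "k i = 0" if "i \<in> I" for i using sum I that by simp
    then have "{} \<in> F i" if "i \<in> I" for i
      using large[OF that] F[OF that] that \<open>V = {}\<close>
      by (cases "F i = {}") (auto simp: subsets_of_card_def)
    then show ?thesis by (intro rainbowI[of I "\<lambda>_. {}"]) (auto simp: disjoint_family_on_def)
  qed (simp add: rainbow_def disjoint_family_on_def)
next
  case False
  define n where "n = card V"
  have n: "n > 0" and r: "card I > 0" using False I n_def by (auto simp: card_gt_0_iff)
  obtain P where P: "\<And>i. i \<in> I \<Longrightarrow> P i \<in> subsets_of_card V (k i)" "disjoint_family_on P I"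
    using ex_disjoint_blocks[OF I V, of k] sum by auto
  define bad where "bad i = {\<sigma>. \<sigma> permutes V \<and> \<sigma> ` P i \<notin> F i}" for i
  have finp: "finite {\<sigma>. \<sigma> permutes V}" by (rule finite_permutations[OF V])
  have bad: "real (card (bad i)) < fact n * (1 - (real (card I) - 1) * real (k i) / n)"
    if i: "i \<in> I" for i
  proof -
    let ?good = "{\<sigma>. \<sigma> permutes V \<and> \<sigma> ` P i \<in> F i}"
    have "bad i = {\<sigma>. \<sigma> permutes V} - ?good" by (auto simp: bad_def)
    then have "card (bad i) = card {\<sigma>. \<sigma> permutes V} - card ?good"
      using finp by (simp add: card_Diff_subset finite_subset[OF _ finp] subset_iff)
    moreover have "card ?good \<le> card {\<sigma>. \<sigma> permutes V}" by (intro card_mono finp) auto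
    moreover have "card {\<sigma>. \<sigma> permutes V} = fact n" unfolding n_def by (rule card_permutations[OF refl V])
    ultimately have b: "real (card (bad i)) = fact n - real (card ?good)" by simp
    have ki: "k i \<le> n" using member_le_sum[OF i _ I, of k] sum n_def by simp
    define c where "c = real (n choose k i)"
    have c: "c > 0" using ki by (simp add: c_def)
    have "card ?good * (n choose k i) = fact n * card (F i)"
      unfolding n_def by (rule card_permutes_image_in[OF V P(1)[OF i] F[OF i]])
    then have g: "real (card ?good) * c = fact n * real (card (F i))"
      unfolding c_def by (metis of_nat_fact of_nat_mult)
    \<comment> \<open>This identity turns the size bound of \<open>F i\<close>, given in terms of
      stars, into the proportion \<open>(card I - 1) * k i / n\<close> of all sets.\<close>
    have s: "real n * real (star_size n (k i)) = real (k i) * c"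
      unfolding c_def using star_size_absorb by (metis of_nat_mult)
    have "real (card I - 1) * real (star_size n (k i)) < real (card (F i))"
      using large[OF i] unfolding n_def[symmetric] by (metis of_nat_less_iff of_nat_mult)
    then have "real n * ((real (card I) - 1) * real (star_size n (k i))) < real n * real (card (F i))"
      using n r by (simp add: of_nat_diff)
    then have "(real (card I) - 1) * (real n * real (star_size n (k i))) < real n * real (card (F i))"
      by (simp only: mult.left_commute)
    then have "(real (card I) - 1) * (real (k i) * c / n) < real (card (F i))"
      using n unfolding s by (simp add: field_simps)
    then have "fact n * ((real (card I) - 1) * (real (k i) * c / n)) < fact n * real (card (F i))"
      by (intro mult_strict_left_mono) auto
    then have "fact n * ((real (card I) - 1) * real (k i) / n) * c < real (card ?good) * c"
      unfolding g by (simp add: mult_ac)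
    then have "fact n * ((real (card I) - 1) * real (k i) / n) < real (card ?good)"
      by (simp only: mult_less_cancel_right_pos[OF c])
    then show ?thesis using b by (simp add: algebra_simps)
  qed
  have "card (\<Union>i\<in>I. bad i) \<le> (\<Sum>i\<in>I. card (bad i))" by (rule card_UN_le[OF I])
  then have "real (card (\<Union>i\<in>I. bad i)) \<le> (\<Sum>i\<in>I. real (card (bad i)))"
    by (metis of_nat_le_iff of_nat_sum)
  also have "\<dots> < (\<Sum>i\<in>I. fact n * (1 - (real (card I) - 1) * real (k i) / n))"
    using I False bad by (intro sum_strict_mono) auto
  also have "\<dots> = fact n * (\<Sum>i\<in>I. 1 - (real (card I) - 1) * real (k i) / n)"
    by (simp add: sum_distrib_left)
  also have "(\<Sum>i\<in>I. 1 - (real (card I) - 1) * real (k i) / n)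
      = real (card I) - (real (card I) - 1) * (\<Sum>i\<in>I. real (k i)) / n"
    by (simp add: sum_subtractf sum_distrib_left sum_divide_distrib)
  also have "(\<Sum>i\<in>I. real (k i)) = n" using sum n_def by (metis of_nat_sum)
  also have "fact n * (real (card I) - (real (card I) - 1) * real n / n) = fact n"
    using n by simp
  finally have "real (card (\<Union>i\<in>I. bad i)) < real (fact n)" by simp
  then have "card (\<Union>i\<in>I. bad i) < card {\<sigma>. \<sigma> permutes V}"
    unfolding n_def card_permutations[OF refl V] by (simp only: of_nat_less_iff)
  moreover have "card {\<sigma>. \<sigma> permutes V} \<le> card (\<Union>i\<in>I. bad i)"
    if "{\<sigma>. \<sigma> permutes V} \<subseteq> (\<Union>i\<in>I. bad i)"
  proof (rule card_mono[OF _ that])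
    show "finite (\<Union>i\<in>I. bad i)" by (rule finite_subset[OF _ finp]) (auto simp: bad_def)
  qed
  ultimately obtain \<sigma> where \<sigma>: "\<sigma> permutes V" "\<sigma> \<notin> (\<Union>i\<in>I. bad i)" by fastforce
  show ?thesis
  proof (rule rainbowI[of I "\<lambda>i. \<sigma> ` P i"])
    show "\<sigma> ` P i \<in> F i" if "i \<in> I" for i using \<sigma> that by (auto simp: bad_def)
    show "disjoint_family_on (\<lambda>i. \<sigma> ` P i) I"
      using P(2) permutes_inj[OF \<sigma>(1)] by (auto simp: disjoint_family_on_def image_Int[symmetric])
  qed
qed

section \<open>Shifting: replacing \<open>v\<close> by \<open>j\<close>\<close>

definition shift :: "'a \<Rightarrow> 'a \<Rightarrow> 'a set set \<Rightarrow> 'a set set" where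
  "shift v j F = (\<lambda>A. if v \<in> A \<and> j \<notin> A \<and> transpose v j ` A \<notin> F then transpose v j ` A else A) ` F"

lemma in_transpose_image_iff: "x \<in> transpose a b ` A \<longleftrightarrow> transpose a b x \<in> A"
  by (metis image_iff transpose_involutory)

lemma transpose_image_involutory: "transpose a b ` (transpose a b ` A) = A"
  by (auto simp: image_image)

text \<open>A moved set lies outside \<open>F\<close>, hence differs from every unmoved one, and two
  moved sets with the same image agree because the transposition is an involution.\<close>

lemma card_shift: "card (shift v j F) = card F"
  unfolding shift_def
proof (rule card_image, rule inj_onI)
  fix A B
  assume "A \<in> F" "B \<in> F"
    "(if v \<in> A \<and> j \<notin> A \<and> transpose v j ` A \<notin> F then transpose v j ` A else A) =
     (if v \<in> B \<and> j \<notin> B \<and> transpose v j ` B \<notin> F then transpose v j ` B else B)"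
  then show "A = B" by (metis transpose_image_involutory)
qed

lemma shift_subsets_of_card:
  assumes "F \<subseteq> subsets_of_card V k" "v \<in> V" "j \<in> V"
  shows "shift v j F \<subseteq> subsets_of_card V k"
proof -
  have "transpose v j ` A \<in> subsets_of_card V k" if "A \<in> subsets_of_card V k" for A
  proof -
    have "transpose v j ` A \<subseteq> V"
      using that assms(2,3) by (auto simp: subsets_of_card_def transpose_def)
    then show ?thesis using that by (simp add: subsets_of_card_def card_image)
  qed
  then show ?thesis using assms(1) by (auto simp: shift_def)
qed

text \<open>A moved set loses \<open>v\<close>, so every set through \<open>v\<close> after the
  shift was there before.\<close>

lemma shift_star_subset:
  assumes "v \<noteq> j"
  shows "{A \<in> shift v j F. v \<in> A} \<subseteq> {A \<in> F. v \<in> A}"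
proof
  fix A assume A: "A \<in> {A \<in> shift v j F. v \<in> A}"
  then obtain B where B: "B \<in> F"
    "A = (if v \<in> B \<and> j \<notin> B \<and> transpose v j ` B \<notin> F then transpose v j ` B else B)"
    by (auto simp: shift_def)
  have "v \<notin> transpose v j ` B" if "j \<notin> B" using that by (simp add: in_transpose_image_iff)
  then show "A \<in> {A \<in> F. v \<in> A}" using A B by (auto split: if_splits)
qed

lemma shift_star_decreases:
  assumes "v \<noteq> j" "finite F" "A \<in> F" "v \<in> A" "j \<notin> A" "transpose v j ` A \<notin> F"
  shows "card {A \<in> shift v j F. v \<in> A} < card {A \<in> F. v \<in> A}"
proof (rule psubset_card_mono)
  have "A \<notin> shift v j F"
  proof
    assume "A \<in> shift v j F"
    then obtain B where B: "B \<in> F"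
      "A = (if v \<in> B \<and> j \<notin> B \<and> transpose v j ` B \<notin> F then transpose v j ` B else B)"
      by (auto simp: shift_def)
    have "v \<notin> transpose v j ` B" if "j \<notin> B" using that by (simp add: in_transpose_image_iff)
    then show False using B assms(4-6) by (auto split: if_splits)
  qed
  then show "{A \<in> shift v j F. v \<in> A} \<subset> {A \<in> F. v \<in> A}"
    using shift_star_subset[OF assms(1), of F] assms(3,4) by blast
qed (use assms in auto)

text \<open>At most one set of a rainbow matching of the shifted families contains \<open>j\<close>. If it is a
  genuinely new set, then transposing \<open>v\<close> and \<open>j\<close> in all sets at once leads back to the
  original families.\<close>

lemma rainbow_shift:
  assumes "v \<noteq> j" "rainbow I (\<lambda>i. shift v j (F i))"
  shows "rainbow I F"
proof -
  obtain A where A: "\<And>i. i \<in> I \<Longrightarrow> A i \<in> shift v j (F i)" "disjoint_family_on A I"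
    using assms(2) unfolding rainbow_def by blast
  show ?thesis
  proof (cases "\<forall>i\<in>I. A i \<in> F i")
    case True
    then show ?thesis using A(2) by (auto intro: rainbowI)
  next
    case False
    then obtain i where i: "i \<in> I" "A i \<notin> F i" by blast
    obtain B where B: "B \<in> F i" "v \<in> B" "j \<notin> B" "A i = transpose v j ` B"
      using A(1)[OF i(1)] i(2) by (auto simp: shift_def split: if_splits)
    then have ji: "j \<in> A i" "v \<notin> A i" "transpose v j ` A i \<in> F i"
      by (simp_all add: in_transpose_image_iff transpose_image_involutory)
    \<comment> \<open>No other \<open>A l\<close> contains \<open>j\<close>. If \<open>v\<close>
      lies in it, it stayed in place only because its transposed set already belongs to
      \<open>F l\<close>; otherwise the transposition fixes it.\<close>
    have "transpose v j ` A l \<in> F l" if l: "l \<in> I" "l \<noteq> i" for l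
    proof -
      have jl: "j \<notin> A l" using disjoint_family_onD[OF A(2) l(1) i(1) l(2)] ji(1) by blast
      obtain B where B: "B \<in> F l"
        "A l = (if v \<in> B \<and> j \<notin> B \<and> transpose v j ` B \<notin> F l then transpose v j ` B else B)"
        using A(1)[OF l(1)] by (auto simp: shift_def)
      have "j \<in> transpose v j ` B" if "v \<in> B" using that by (simp add: in_transpose_image_iff)
      then have AB: "A l = B" "v \<in> B \<longrightarrow> transpose v j ` B \<in> F l"
        using B(2) jl by (auto split: if_splits)
      show ?thesis
      proof (cases "v \<in> B")
        case False
        then have "transpose v j ` A l = A l"
          using AB jl by (auto simp: transpose_def image_iff)
        then show ?thesis using B(1) AB by simp
      qed (use AB in simp)
    qed
    then have "transpose v j ` A l \<in> F l" if "l \<in> I" for l using ji(3) that by (cases "l = i") auto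
    moreover have "disjoint_family_on (\<lambda>l. transpose v j ` A l) I"
      using A(2) by (auto simp: disjoint_family_on_def inj_transpose image_Int[symmetric])
    ultimately show ?thesis by (rule rainbowI)
  qed
qed

text \<open>Among all tuples of families with the given sizes and without a rainbow matching, one
  with the least total degree of \<open>v\<close> is stable: a shift that moves some set keeps these
  properties and lowers the degree.\<close>

lemma ex_stable_family:
  assumes "finite I" "finite V" "v \<in> V"
    and F: "\<And>i. i \<in> I \<Longrightarrow> F i \<subseteq> subsets_of_card V (k i)"
    and "\<not> rainbow I F"
  shows "\<exists>G. (\<forall>i\<in>I. G i \<subseteq> subsets_of_card V (k i) \<and> card (G i) = card (F i)) \<and> \<not> rainbow I G \<and>
    (\<forall>i\<in>I. \<forall>A\<in>G i. \<forall>j\<in>V. v \<in> A \<longrightarrow> j \<notin> A \<longrightarrow> transpose v j ` A \<in> G i)"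
proof -
  define P where "P G \<longleftrightarrow> (\<forall>i\<in>I. G i \<subseteq> subsets_of_card V (k i) \<and> card (G i) = card (F i)) \<and>
    \<not> rainbow I G" for G
  define m where "m G = (\<Sum>i\<in>I. card {A \<in> G i. v \<in> A})" for G
  have "P F" using assms by (auto simp: P_def)
  then obtain G where G: "P G" and min: "\<And>G'. P G' \<Longrightarrow> m G \<le> m G'"
    using ex_has_least_nat[of P F m] by blast
  have "transpose v j ` A \<in> G i"
    if i: "i \<in> I" and A: "A \<in> G i" and j: "j \<in> V" and vj: "v \<in> A" "j \<notin> A" for i A j
  proof (rule ccontr)
    assume no: "transpose v j ` A \<notin> G i"
    have ne: "v \<noteq> j" using vj by blast
    have fin: "finite (G l)" if "l \<in> I" for l
      using G that assms(2) unfolding P_def by (meson finite_subset finite_subsets_of_card)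
    let ?G = "\<lambda>l. shift v j (G l)"
    have "P ?G"
      using G rainbow_shift[OF ne] shift_subsets_of_card[OF _ assms(3) j]
      unfolding P_def by (auto simp: card_shift)
    moreover have "m ?G < m G" unfolding m_def
    proof (rule sum_strict_mono_ex1[OF assms(1)])
      show "\<forall>l\<in>I. card {A \<in> ?G l. v \<in> A} \<le> card {A \<in> G l. v \<in> A}"
        using shift_star_subset[OF ne] fin by (intro ballI card_mono) auto
      show "\<exists>l\<in>I. card {A \<in> ?G l. v \<in> A} < card {A \<in> G l. v \<in> A}"
        using i shift_star_decreases[OF ne fin[OF i] A vj no] by blast
    qed
    ultimately show False using min[of ?G] by simp
  qed
  then show ?thesis using G unfolding P_def by blast
qed

text \<open>The lemma of Huang, Loh and Sudakov, by induction on \<open>card V\<close>. If the sizes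
  do not fill \<open>V\<close>, a point \<open>v\<close> is deleted: each family is replaced by its
  link at \<open>v\<close> if that is large enough, and otherwise by its members avoiding
  \<open>v\<close>. The matched links are completed by spare points in place of \<open>v\<close>,
  which stability permits.\<close>

theorem rainbow_of_large_families:
  assumes "finite I" "finite V"
    and "\<And>i. i \<in> I \<Longrightarrow> F i \<subseteq> subsets_of_card V (k i)"
    and "(\<Sum>i\<in>I. k i) \<le> card V"
    and "\<And>i. i \<in> I \<Longrightarrow> card (F i) > (card I - 1) * star_size (card V) (k i)"
  shows "rainbow I F"
  using assms(2-)
proof (induction "card V" arbitrary: V F k rule: less_induct)
  case less
  show ?case
  proof (cases "(\<Sum>i\<in>I. k i) = card V")
    case True
    then show ?thesis using less.prems assms(1) by (intro rainbow_exact[of I V F k]) auto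
  next
    case False
    then have lt: "(\<Sum>i\<in>I. k i) < card V" using less.prems(3) by simp
    then obtain v where v: "v \<in> V" by fastforce
    show ?thesis
    proof (rule ccontr)
      assume "\<not> ?thesis"
      then obtain G where G: "\<And>i. i \<in> I \<Longrightarrow> G i \<subseteq> subsets_of_card V (k i)"
          "\<And>i. i \<in> I \<Longrightarrow> card (G i) = card (F i)" "\<not> rainbow I G"
        and stable: "\<And>i A j. i \<in> I \<Longrightarrow> A \<in> G i \<Longrightarrow> j \<in> V \<Longrightarrow> v \<in> A \<Longrightarrow> j \<notin> A \<Longrightarrow> transpose v j ` A \<in> G i"
        using ex_stable_family[OF assms(1) less.prems(1) v, of F k] less.prems(2) by metis
      define W where "W = V - {v}"
      have W: "finite W" "card W = card V - 1" "card V > 0"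
        using less.prems(1) v by (auto simp: W_def card_gt_0_iff)
      define L where "L i = (\<lambda>A. A - {v}) ` {A \<in> G i. v \<in> A}" for i
      define R where "R i = {A \<in> G i. v \<notin> A}" for i
      define J where "J = {i \<in> I. card (L i) > (card I - 1) * star_size (card W) (k i - 1)}"
      have J: "J \<subseteq> I" "finite J" using assms(1) by (auto simp: J_def)
      \<comment> \<open>A link that exceeds the bound is nonempty, so \<open>k i - 1\<close> is not
        truncated for \<open>i\<close> in \<open>J\<close>.\<close>
      have kpos: "k i > 0" if "i \<in> J" for i
      proof -
        have "L i \<noteq> {}" using that unfolding J_def by fastforce
        then obtain A where "A \<in> G i" "v \<in> A" by (auto simp: L_def)
        then have "card A = k i" "v \<in> A" "finite A"
          using G(1)[of i] that J less.prems(1) by (auto simp: subsets_of_card_def dest: finite_subset)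
        then show ?thesis by (metis card_gt_0_iff empty_iff)
      qed
      define k' where "k' i = (if i \<in> J then k i - 1 else k i)" for i
      define F' where "F' i = (if i \<in> J then L i else R i)" for i
      have sumk: "(\<Sum>i\<in>I. k' i) + card J = (\<Sum>i\<in>I. k i)"
      proof -
        have "(\<Sum>i\<in>I. k i) = (\<Sum>i\<in>I. k' i + (if i \<in> J then 1 else 0))"
          using kpos by (intro sum.cong) (auto simp: k'_def)
        also have "\<dots> = (\<Sum>i\<in>I. k' i) + card J"
          using J assms(1) by (simp add: sum.distrib sum.If_cases Int_absorb1)
        finally show ?thesis by simp
      qed
      have "rainbow I F'"
      proof (rule less.hyps[of W F' k'])
        show "card W < card V" "finite W" using W by auto
        show "(\<Sum>i\<in>I. k' i) \<le> card W" using sumk lt W by simp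
      next
        fix i assume i: "i \<in> I"
        have "A - {v} \<in> subsets_of_card W (k i - 1)" if "A \<in> G i" "v \<in> A" for A
          using that G(1)[OF i] by (auto simp: subsets_of_card_def W_def)
        moreover have "R i \<subseteq> subsets_of_card W (k i)"
          using G(1)[OF i] by (auto simp: subsets_of_card_def W_def R_def)
        ultimately show "F' i \<subseteq> subsets_of_card W (k' i)" by (auto simp: F'_def k'_def L_def)
      next
        fix i assume i: "i \<in> I"
        show "card (F' i) > (card I - 1) * star_size (card W) (k' i)"
        proof (cases "i \<in> J")
          case True
          then show ?thesis by (simp add: F'_def k'_def J_def)
        next
          case False
          have finG: "finite (G i)"
            using G(1)[OF i] less.prems(1) by (meson finite_subset finite_subsets_of_card)
          have "card (G i) = card {A \<in> G i. v \<in> A} + card (R i)"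
            unfolding R_def using finG
            by (subst card_Un_disjoint[symmetric]) (auto intro: arg_cong[where f = card])
          also have "card {A \<in> G i. v \<in> A} = card (L i)"
            unfolding L_def by (rule card_image[symmetric]) (auto simp: inj_on_def)
          finally have c: "card (G i) = card (L i) + card (R i)" .
          have "(card I - 1) * star_size (card V) (k i) < card (L i) + card (R i)"
            using less.prems(4)[OF i] G(2)[OF i] c by simp
          moreover have "card (L i) \<le> (card I - 1) * star_size (card W) (k i - 1)"
            using False i by (simp add: J_def)
          \<comment> \<open>Pascal's rule. For \<open>k i = 1\<close> it relies on the value 0 of
            \<open>star_size\<close> at 0.\<close>
          moreover have "star_size (card W) (k i - 1) + star_size (card W) (k i) \<le> star_size (card V) (k i)"
          proof (cases "k i = 0")
            case True
            then show ?thesis by (simp add: star_size_def)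
          next
            case False
            have "k i \<le> (\<Sum>i\<in>I. k i)" using assms(1) i by (simp add: member_le_sum)
            then have "card W > 0" using False lt W by simp
            show ?thesis
            proof (cases "k i = 1")
              case False
              then obtain a where "k i = 2 + a"
                using \<open>k i \<noteq> 0\<close> nat_le_iff_add[of 2 "k i"] by auto
              moreover obtain b where "card V = 2 + b"
                using \<open>card W > 0\<close> W(2) nat_le_iff_add[of 2 "card V"] by auto
              ultimately show ?thesis using W(2) by (simp add: star_size_def)
            qed (simp add: star_size_def)
          qed
          then have "(card I - 1) * star_size (card W) (k i - 1) + (card I - 1) * star_size (card W) (k i)
              \<le> (card I - 1) * star_size (card V) (k i)"
            by (metis add_mult_distrib2 mult_le_mono2)
          ultimately have "(card I - 1) * star_size (card W) (k i) < card (R i)" by linarith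
          then show ?thesis using False by (simp add: F'_def k'_def)
        qed
      qed
      then obtain A where A: "\<And>i. i \<in> I \<Longrightarrow> A i \<in> F' i" "disjoint_family_on A I"
        unfolding rainbow_def by blast
      have AW: "A i \<subseteq> W" "card (A i) = k' i" if "i \<in> I" for i
      proof -
        have "A i \<in> L i \<and> i \<in> J \<or> A i \<in> R i \<and> i \<notin> J" using A(1)[OF that] by (auto simp: F'_def split: if_splits)
        then show "A i \<subseteq> W" "card (A i) = k' i"
          using G(1)[OF that]
          by (auto simp: L_def R_def W_def k'_def subsets_of_card_def)
      qed
      define U where "U = (\<Union>i\<in>I. A i)"
      have "U \<subseteq> W" using AW by (auto simp: U_def)
      have "card U \<le> (\<Sum>i\<in>I. card (A i))" unfolding U_def by (rule card_UN_le[OF assms(1)])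
      also have "\<dots> = (\<Sum>i\<in>I. k' i)" using AW by (intro sum.cong) auto
      \<comment> \<open>At most \<open>sum k I - card J\<close> points of \<open>W\<close> are used,
        and \<open>sum k I\<close> is at most \<open>card W\<close>. Hence each index in
        \<open>J\<close> gets a spare point of its own.\<close>
      finally have "card J \<le> card (W - U)"
        using sumk lt W \<open>U \<subseteq> W\<close> by (simp add: card_Diff_subset finite_subset)
      then obtain w where w: "inj_on w J" "w ` J \<subseteq> W - U"
        using card_le_inj[OF J(2), of "W - U"] W(1) by auto
      define B where "B i = (if i \<in> J then insert (w i) (A i) else A i)" for i
      have "B i \<in> G i" if i: "i \<in> I" for i
      proof (cases "i \<in> J")
        case True
        then obtain S where S: "S \<in> G i" "v \<in> S" "A i = S - {v}"
          using A(1)[OF i] by (auto simp: F'_def L_def)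
        have wi: "w i \<in> W" "w i \<notin> A i" using w(2) True i by (auto simp: U_def)
        then have "w i \<notin> S" "w i \<in> V" "w i \<noteq> v" using S by (auto simp: W_def)
        then have "transpose v (w i) ` S \<in> G i" using stable[OF i S(1)] S(2) by blast
        also have "transpose v (w i) ` S = insert (w i) (S - {v})"
          using S(2) \<open>w i \<notin> S\<close> by (auto simp: transpose_def image_iff)
        finally show ?thesis using True S(3) by (simp add: B_def)
      next
        case False
        then show ?thesis using A(1)[OF i] by (auto simp: B_def F'_def R_def)
      qed
      moreover have "disjoint_family_on B I"
      proof -
        have "B i \<inter> B l = {}" if il: "i \<in> I" "l \<in> I" "i \<noteq> l" for i l
        proof -
          have "A i \<inter> A l = {}" using disjoint_family_onD[OF A(2) il] .
          moreover have "w x \<notin> A y" if "x \<in> J" "y \<in> I" for x y using w(2) that by (auto simp: U_def)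
          moreover have "w i \<noteq> w l" if "i \<in> J" "l \<in> J" using w(1) that il by (auto dest: inj_onD)
          ultimately show ?thesis using il by (auto simp: B_def)
        qed
        then show ?thesis by (auto simp: disjoint_family_on_def)
      qed
      ultimately show False using G(3) rainbowI by metis
    qed
  qed
qed

section \<open>Vertices of high degree\<close>

text \<open>The Huang-Loh-Sudakov lemma for \<open>card I\<close> copies of one family.\<close>

lemma card_le_of_no_rainbow:
  assumes "finite I" "finite V" "F \<subseteq> subsets_of_card V k" "card I * k \<le> card V"
    and "\<not> rainbow I (\<lambda>_. F)"
  shows "card F \<le> (card I - 1) * star_size (card V) k"
proof (rule ccontr)
  assume "\<not> ?thesis"
  then have "rainbow I (\<lambda>_. F)"
    using assms(1-4) by (intro rainbow_of_large_families[of I V _ "\<lambda>_. k"]) auto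
  then show False using assms(5) by simp
qed

text \<open>The points of a matching that cannot be enlarged meet every set of \<open>F\<close>. The
  induction on \<open>I\<close> finds an index at which a matching of the previous indices cannot be
  extended.\<close>

lemma ex_cover_of_no_rainbow:
  assumes "finite I" "finite V" "F \<subseteq> subsets_of_card V k" "\<not> rainbow I (\<lambda>_. F)"
  shows "\<exists>Z\<subseteq>V. card Z \<le> k * (card I - 1) \<and> (\<forall>A\<in>F. A \<inter> Z \<noteq> {})"
  using assms(1,4)
proof (induction I rule: finite_induct)
  case empty
  then show ?case by (simp add: rainbow_def disjoint_family_on_def)
next
  case (insert i I)
  show ?case
  proof (cases "rainbow I (\<lambda>_. F)")
    case True
    then obtain A where A: "\<And>i. i \<in> I \<Longrightarrow> A i \<in> F" "disjoint_family_on A I"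
      unfolding rainbow_def by blast
    have AV: "A i \<subseteq> V \<and> card (A i) = k" if "i \<in> I" for i
      using A(1)[OF that] assms(3) by (auto simp: subsets_of_card_def)
    have "card (\<Union>i\<in>I. A i) \<le> (\<Sum>i\<in>I. card (A i))" by (rule card_UN_le[OF insert.hyps(1)])
    also have "\<dots> = k * (card (insert i I) - 1)" using AV insert.hyps by simp
    finally have "card (\<Union>i\<in>I. A i) \<le> k * (card (insert i I) - 1)" .
    moreover have "B \<inter> (\<Union>i\<in>I. A i) \<noteq> {}" if B: "B \<in> F" for B
    proof
      assume no: "B \<inter> (\<Union>i\<in>I. A i) = {}"
      have "rainbow (insert i I) (\<lambda>_. F)"
      proof (rule rainbowI[of _ "A(i := B)"])
        have "disjoint_family_on (A(i := B)) I"
          using A(2) insert.hyps(2) by (simp add: disjoint_family_on_def)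
        moreover have "(A(i := B)) ` I = A ` I" using insert.hyps(2) by auto
        ultimately show "disjoint_family_on (A(i := B)) (insert i I)"
          using no insert.hyps(2) by (simp add: disjoint_family_on_insert)
      qed (use A(1) B in auto)
      then show False using insert.prems by simp
    qed
    moreover have "(\<Union>i\<in>I. A i) \<subseteq> V" using AV by auto
    ultimately show ?thesis by (intro exI[of _ "\<Union>i\<in>I. A i"]) simp
  next
    case False
    then obtain Z where "Z \<subseteq> V" "card Z \<le> k * (card I - 1)" "\<forall>A\<in>F. A \<inter> Z \<noteq> {}"
      using insert.IH by blast
    moreover have "k * (card I - 1) \<le> k * (card (insert i I) - 1)"
      using insert.hyps by (intro mult_le_mono2) simp
    ultimately show ?thesis by (meson le_trans)
  qed
qed

text \<open>Points of very high degree in the smallest family can be matched last.\<close>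

lemma delete_high_degree:
  assumes V: "finite V" and k: "k > 0"
    and B: "\<And>j. j \<le> u \<Longrightarrow> B j \<subseteq> subsets_of_card V k" "\<And>j. j \<le> u \<Longrightarrow> B 0 \<subseteq> B j"
    and no: "\<not> rainbow {..u} B"
    and H: "H \<subseteq> V"
      "\<And>x. x \<in> H \<Longrightarrow> card {A \<in> B 0. x \<in> A} > k * u * star_size (card V - 1) (k - 1)"
  shows "card H \<le> u" "\<not> rainbow {card H..u} (\<lambda>j. {A \<in> B j. A \<inter> H = {}})"
proof -
  \<comment> \<open>There are only \<open>Suc u\<close> families, so at most that many points of
    \<open>H\<close> can be used. The cap disappears once \<open>card H \<le> u\<close> is
    known.\<close>
  define t where "t = min (card H) (Suc u)"
  have "finite H" using finite_subset[OF H(1) V] .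
  then obtain x where x: "inj_on x {..<t}" "x ` {..<t} \<subseteq> H"
    using card_le_inj[of "{..<t}" H] by (auto simp: t_def)
  have no': "\<not> rainbow {t..u} (\<lambda>j. {A \<in> B j. A \<inter> H = {}})"
  proof
    assume "rainbow {t..u} (\<lambda>j. {A \<in> B j. A \<inter> H = {}})"
    then obtain A where A: "\<And>i. i \<in> {t..u} \<Longrightarrow> A i \<in> B i \<and> A i \<inter> H = {}" "disjoint_family_on A {t..u}"
      unfolding rainbow_def by blast
    have D: "{..u} - {..<t} = {t..u}" by auto
    have "rainbow {..u} B"
    \<comment> \<open>Each index \<open>j < t\<close> keeps the point \<open>x j\<close> free for a
      set of \<open>B 0\<close> through it; the other indices already have sets avoiding
      \<open>H\<close>.\<close>
    proof (rule rainbow_extend[of "{..u}" "{..<t}" V B k "\<lambda>j. {x j}" A])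
      show "{..<t} \<subseteq> {..u}" by (auto simp: t_def)
      show "disjoint_family_on (\<lambda>j. {x j}) {..<t}"
        using x(1) by (auto simp: disjoint_family_on_def inj_on_def)
      show "{x j} \<subseteq> V \<and> card {x j} \<le> k" if "j \<in> {..<t}" for j using x H k that by auto
    next
      fix j Z assume j: "j \<in> {..<t}" and Z: "Z \<subseteq> V" "card Z \<le> k * (card {..u} - 1)" "Z \<inter> {x j} = {}"
      have xj: "x j \<in> H" "x j \<in> V" using j x H by auto
      \<comment> \<open>Each point of \<open>Z\<close> spoils at most as many sets through
        \<open>x j\<close> as there are \<open>k\<close>-sets through two points. The degree of
        \<open>x j\<close> exceeds the total, so some set remains.\<close>
      have "card {A \<in> B 0. x j \<in> A \<and> A \<inter> Z \<noteq> {}} \<le> card Z * star_size (card V - 1) (k - 1)"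
        using V B(1)[of 0] Z xj by (intro card_through_meeting_le) auto
      also have "\<dots> \<le> k * u * star_size (card V - 1) (k - 1)" using Z by (intro mult_le_mono1) simp
      also have "\<dots> < card {A \<in> B 0. x j \<in> A}" by (rule H(2)[OF xj(1)])
      finally have "{A \<in> B 0. x j \<in> A} \<noteq> {A \<in> B 0. x j \<in> A \<and> A \<inter> Z \<noteq> {}}"
        by (metis less_irrefl)
      then obtain A where "A \<in> B 0" "A \<inter> Z = {}" by blast
      then show "\<exists>A\<in>B j. A \<inter> Z = {}" using B(2)[of j] j by (auto simp: t_def)
    next
      fix i j assume "i \<in> {..u} - {..<t}" "j \<in> {..<t}"
      then show "A i \<inter> {x j} = {}" using A(1)[of i] x(2) D by blast
    qed (use V B A D in auto)
    then show False using no by simp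
  qed
  show "card H \<le> u"
  proof (rule ccontr)
    assume "\<not> ?thesis"
    \<comment> \<open>With a point of \<open>H\<close> for every family no index is left over, and
      the empty matching contradicts \<open>no'\<close>.\<close>
    then have "{t..u} = {}" by (simp add: t_def)
    then show False using no' by (simp add: rainbow_def disjoint_family_on_def)
  qed
  then show "\<not> rainbow {card H..u} (\<lambda>j. {A \<in> B j. A \<inter> H = {}})" using no' by (simp add: t_def)
qed

lemma star_size_mono: "n \<le> n' \<Longrightarrow> star_size n k \<le> star_size n' k"
  by (auto simp: star_size_def intro!: binomial_right_mono)

text \<open>Suppose that \<open>T\<close> contains distinct points \<open>y i\<close> for all
  \<open>i\<close> in \<open>I\<close>. Half of the degree bound absorbs the sets containing another
  of these points; the other half makes the links at \<open>y i\<close> outside \<open>Y\<close>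
  large enough to be matched, and putting the \<open>y i\<close> back gives a rainbow
  matching.\<close>

lemma few_medium_degree:
  assumes "finite I" "finite V" "F \<subseteq> subsets_of_card V k" "\<not> rainbow I (\<lambda>_. F)"
    and "k > 0" "I \<noteq> {}" "card I * k \<le> card V"
    and T: "T \<subseteq> V"
      "\<And>x. x \<in> T \<Longrightarrow> card {A \<in> F. x \<in> A} > 2 * (card I - 1) * star_size (card V - 1) (k - 1)"
  shows "card T < card I"
proof (rule ccontr)
  let ?c = "star_size (card V - 1) (k - 1)"
  assume "\<not> ?thesis"
  moreover have "finite T" using finite_subset[OF T(1) assms(2)] .
  ultimately obtain y where y: "inj_on y I" "y ` I \<subseteq> T"
    using card_le_inj[of I T] assms(1) by auto
  define Y where "Y = y ` I"
  have Y: "Y \<subseteq> V" "card Y = card I" "finite Y" 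
    using y T assms(1) by (auto simp: Y_def card_image)
  have I: "card I > 0" using assms by (simp add: card_gt_0_iff)
  define M where "M i = {A \<in> F. y i \<in> A \<and> A \<inter> (Y - {y i}) = {}}" for i
  define L where "L i = (\<lambda>A. A - {y i}) ` M i" for i
  have finF: "finite F" using finite_subset[OF assms(3)] assms(2) by simp
  have "rainbow I L"
  proof (rule rainbow_of_large_families[of I "V - Y" L "\<lambda>_. k - 1"])
    have "card (V - Y) = card V - card I" using Y by (simp add: card_Diff_subset)
    \<comment> \<open>The ground set loses one point per index, but the links are also one point
      smaller than the sets.\<close>
    then show "(\<Sum>i\<in>I. k - 1) \<le> card (V - Y)"
      using assms(7) by (simp add: diff_mult_distrib2)
  next
    fix i assume i: "i \<in> I"
    show "L i \<subseteq> subsets_of_card (V - Y) (k - 1)"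
      using assms(3) by (auto simp: L_def M_def subsets_of_card_def)
    have yi: "y i \<in> Y" "y i \<in> T" "y i \<in> V" using i y Y by (auto simp: Y_def)
    have "{A \<in> F. y i \<in> A} = M i \<union> {A \<in> F. y i \<in> A \<and> A \<inter> (Y - {y i}) \<noteq> {}}"
      by (auto simp: M_def)
    then have "card {A \<in> F. y i \<in> A} = card (M i \<union> {A \<in> F. y i \<in> A \<and> A \<inter> (Y - {y i}) \<noteq> {}})"
      by (rule arg_cong)
    also have "\<dots> \<le> card (M i) + card {A \<in> F. y i \<in> A \<and> A \<inter> (Y - {y i}) \<noteq> {}}"
      by (rule card_Un_le)
    also have "card {A \<in> F. y i \<in> A \<and> A \<inter> (Y - {y i}) \<noteq> {}} \<le> card (Y - {y i}) * ?c"
      using assms Y yi by (intro card_through_meeting_le) auto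
    also have "card (Y - {y i}) = card I - 1" using Y yi by simp
    finally have "card {A \<in> F. y i \<in> A} \<le> card (M i) + (card I - 1) * ?c" by simp
    moreover have "card {A \<in> F. y i \<in> A} > 2 * ((card I - 1) * ?c)" using T(2)[OF yi(2)] by simp
    ultimately have "(card I - 1) * ?c < card (M i)" by linarith
    moreover have "card (L i) = card (M i)"
      unfolding L_def by (rule card_image) (auto simp: inj_on_def M_def)
    moreover have "(card I - 1) * star_size (card (V - Y)) (k - 1) \<le> (card I - 1) * ?c"
      using Y I by (intro mult_le_mono2 star_size_mono) (simp add: card_Diff_subset)
    ultimately show "card (L i) > (card I - 1) * star_size (card (V - Y)) (k - 1)" by linarith
  qed (use assms in auto)
  then obtain A where A: "\<And>i. i \<in> I \<Longrightarrow> A i \<in> L i" "disjoint_family_on A I"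
    unfolding rainbow_def by blast
  have A': "insert (y i) (A i) \<in> F \<and> A i \<inter> Y = {}" if i: "i \<in> I" for i
  proof -
    obtain S where "S \<in> F" "y i \<in> S" "S \<inter> (Y - {y i}) = {}" "A i = S - {y i}"
      using A(1)[OF i] by (auto simp: L_def M_def)
    then show ?thesis by (simp add: insert_absorb) blast
  qed
  have "rainbow I (\<lambda>_. F)"
  proof (rule rainbowI[of I "\<lambda>i. insert (y i) (A i)"])
    have "insert (y i) (A i) \<inter> insert (y l) (A l) = {}" if il: "i \<in> I" "l \<in> I" "i \<noteq> l" for i l
    proof -
      have "A i \<inter> A l = {}" by (rule disjoint_family_onD[OF A(2) il])
      moreover have "y i \<noteq> y l" using y(1) il by (auto dest: inj_onD)
      ultimately show ?thesis using A'[OF il(1)] A'[OF il(2)] il by (auto simp: Y_def)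
    qed
    then show "disjoint_family_on (\<lambda>i. insert (y i) (A i)) I" by (auto simp: disjoint_family_on_def)
  qed (use A' in auto)
  then show False using assms(4) by simp
qed

text \<open>A cover \<open>Z\<close> of at most \<open>k * (card I - 1)\<close> points has at most
  \<open>card I - 1\<close> points of degree above \<open>2 * s * ?c\<close>, and those have degree
  at most \<open>k * s * ?c\<close>. The factor 3 is \<open>1 + 2\<close>, one summand for each kind
  of point.\<close>

lemma card_le_of_bounded_degree:
  assumes "finite I" "finite V" "F \<subseteq> subsets_of_card V k" "\<not> rainbow I (\<lambda>_. F)"
    and "k > 0" "card I * k \<le> card V" "card I \<le> Suc s"
    and deg: "\<And>x. x \<in> V \<Longrightarrow> card {A \<in> F. x \<in> A} \<le> k * s * star_size (card V - 1) (k - 1)"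
  shows "card F \<le> 3 * k * s * (card I - 1) * star_size (card V - 1) (k - 1)"
proof -
  let ?c = "star_size (card V - 1) (k - 1)"
  have I: "I \<noteq> {}" using assms(4) by (auto simp: rainbow_def disjoint_family_on_def)
  define T where "T = {x \<in> V. card {A \<in> F. x \<in> A} > 2 * s * ?c}"
  have "2 * (card I - 1) * ?c \<le> 2 * s * ?c" using assms(7) by (intro mult_le_mono1) simp
  then have "2 * (card I - 1) * ?c < card {A \<in> F. x \<in> A}" if "x \<in> T" for x
    using that unfolding T_def by (metis (no_types, lifting) le_less_trans mem_Collect_eq)
  then have "card T < card I"
    using assms(1-6) I by (intro few_medium_degree[of I V F k T]) (auto simp: T_def)
  then have T: "card T \<le> card I - 1" by simp
  obtain Z where Z: "Z \<subseteq> V" "card Z \<le> k * (card I - 1)" "\<forall>A\<in>F. A \<inter> Z \<noteq> {}"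
    using ex_cover_of_no_rainbow[OF assms(1-4)] by blast
  have fin: "finite Z" "finite T" "finite F"
    using Z assms(2) finite_subset[OF assms(3)] by (auto simp: T_def intro: finite_subset)
  have "{A \<in> F. A \<inter> Z \<noteq> {}} = F" using Z(3) by blast
  then have "card F \<le> (\<Sum>z\<in>Z. card {A \<in> F. z \<in> A})"
    using card_meeting_le_sum[OF fin(3,1)] by simp
  also have "\<dots> = (\<Sum>z\<in>Z \<inter> T. card {A \<in> F. z \<in> A}) + (\<Sum>z\<in>Z - T. card {A \<in> F. z \<in> A})"
    by (rule sum.Int_Diff[OF fin(1)])
  also have "\<dots> \<le> card (Z \<inter> T) * (k * s * ?c) + card (Z - T) * (2 * s * ?c)"
  proof (intro add_mono)
    show "(\<Sum>z\<in>Z \<inter> T. card {A \<in> F. z \<in> A}) \<le> card (Z \<inter> T) * (k * s * ?c)"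
      using sum_bounded_above[of "Z \<inter> T" "\<lambda>z. card {A \<in> F. z \<in> A}" "k * s * ?c"] deg Z(1) by auto
    show "(\<Sum>z\<in>Z - T. card {A \<in> F. z \<in> A}) \<le> card (Z - T) * (2 * s * ?c)"
      using sum_bounded_above[of "Z - T" "\<lambda>z. card {A \<in> F. z \<in> A}" "2 * s * ?c"] Z(1)
      by (auto simp: T_def not_less)
  qed
  also have "\<dots> \<le> (card I - 1) * (k * s * ?c) + (k * (card I - 1)) * (2 * s * ?c)"
  proof (intro add_mono mult_le_mono1)
    show "card (Z \<inter> T) \<le> card I - 1" using card_mono[OF fin(2), of "Z \<inter> T"] T by auto
    show "card (Z - T) \<le> k * (card I - 1)" using card_mono[OF fin(1), of "Z - T"] Z(2) by auto
  qed
  also have "\<dots> = 3 * k * s * (card I - 1) * ?c" by algebra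
  finally show ?thesis .
qed

section \<open>Small families\<close>

lemma card_meeting:
  assumes "finite V" "H \<subseteq> V"
  shows "real (card {A \<in> subsets_of_card V k. A \<inter> H \<noteq> {}})
    = real (card V choose k) - real ((card V - card H) choose k)"
proof -
  have eq: "subsets_of_card V k = {A \<in> subsets_of_card V k. A \<inter> H \<noteq> {}} \<union> subsets_of_card (V - H) k"
    by (auto simp: subsets_of_card_def)
  have "card (subsets_of_card V k) = card {A \<in> subsets_of_card V k. A \<inter> H \<noteq> {}} + card (subsets_of_card (V - H) k)"
    by (subst eq, rule card_Un_disjoint) (use assms in \<open>auto simp: subsets_of_card_def\<close>)
  moreover have "finite H" using assms finite_subset by blast
  ultimately show ?thesis using assms by (simp add: card_subsets_of_card card_Diff_subset)
qed

text \<open>Pascal's rule telescopes the difference into \<open>d\<close> terms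
  \<open>(N + i) choose j\<close>. The smallest of them gives this lower bound, the largest the
  upper bound that follows.\<close>

lemma binomial_add_ge: "((N + d) choose Suc j) \<ge> (N choose Suc j) + d * (N choose j)"
proof (induction d)
  case (Suc d)
  have "N choose j \<le> (N + d) choose j" by (rule binomial_right_mono) simp
  then show ?case using Suc by simp
qed simp

lemma binomial_add_le: "((N + d) choose Suc j) \<le> (N choose Suc j) + d * ((N + d - 1) choose j)"
proof (induction d)
  case (Suc d)
  have "(N + d - 1) choose j \<le> (N + d) choose j" by (rule binomial_right_mono) simp
  then have "d * ((N + d - 1) choose j) \<le> d * ((N + d) choose j)" by (rule mult_le_mono2)
  moreover have "(N + Suc d) choose Suc j = ((N + d) choose Suc j) + ((N + d) choose j)" by simp
  moreover have "Suc d * ((N + Suc d - 1) choose j) = ((N + d) choose j) + d * ((N + d) choose j)" by simp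
  ultimately show ?case using Suc by linarith
qed simp

text \<open>The weaker \<open>(n - s) choose (k - 1)\<close> in place of
  \<open>(n - u) choose (k - 1)\<close> gives one constant for all pairs
  \<open>h \<le> u\<close>.\<close>

lemma binomial_diff_ge:
  assumes "h \<le> u" "u \<le> s" "s \<le> n" "k > 0"
  shows "real ((n - h) choose k) - real ((n - u) choose k) \<ge> real (u - h) * real ((n - s) choose (k - 1))"
proof -
  have "(n - s) choose (k - 1) \<le> (n - u) choose (k - 1)"
    using assms by (intro binomial_right_mono) simp
  then have "(u - h) * ((n - s) choose (k - 1)) \<le> (u - h) * ((n - u) choose (k - 1))" by (rule mult_le_mono2)
  moreover have "((n - h) choose k) \<ge> ((n - u) choose k) + (u - h) * ((n - u) choose (k - 1))"
    using binomial_add_ge[where N = "n - u" and d = "u - h" and j = "k - 1"] assms by simp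
  ultimately have "(u - h) * ((n - s) choose (k - 1)) + ((n - u) choose k) \<le> ((n - h) choose k)" by linarith
  then have "real ((u - h) * ((n - s) choose (k - 1)) + ((n - u) choose k)) \<le> real ((n - h) choose k)"
    by (simp only: of_nat_le_iff)
  then show ?thesis by simp
qed

lemma binomial_diff_le:
  assumes "u \<le> n" "k > 0"
  shows "real (n choose k) - real ((n - u) choose k) \<le> real u * real (star_size n k)"
proof -
  have "(n choose k) \<le> ((n - u) choose k) + u * star_size n k"
    using binomial_add_le[where N = "n - u" and d = u and j = "k - 1"] assms by (simp add: star_size_def)
  then have "real (n choose k) \<le> real (((n - u) choose k) + u * star_size n k)"
    by (simp only: of_nat_le_iff)
  then show ?thesis by simp
qed

lemma star_size_diff_le:
  assumes "0 < s" "s \<le> n" "k > 0"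
  shows "real (star_size n k) - real ((n - s) choose (k - 1)) \<le> real (s - 1) * real (star_size (n - 1) (k - 1))"
proof (cases "k = 1")
  case True
  then show ?thesis by (simp add: star_size_def)
next
  case False
  then show ?thesis using binomial_diff_le[of "s - 1" "n - 1" "k - 1"] assms
    by (simp add: star_size_def)
qed

lemma size_bounds:
  fixes k s n :: nat
  assumes k: "k > 0" and s: "s > 0" and n: "n \<ge> 4 * k\<^sup>2 * s"
  shows "k * s + s \<le> n" "Suc s * k \<le> n" "s + k \<le> n" "2 \<le> n"
proof -
  have "k \<le> k\<^sup>2" "1 \<le> k\<^sup>2" using k by (simp_all add: power2_nat_le_imp_le power2_eq_square)
  then have "k * s \<le> k\<^sup>2 * s" "1 * s \<le> k\<^sup>2 * s" "k * 1 \<le> k\<^sup>2 * s"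
    using s by (intro mult_le_mono; simp)+
  moreover have "0 < k\<^sup>2 * s" using s k by simp
  moreover have "4 * (k\<^sup>2 * s) \<le> n" using n by simp
  moreover have "Suc s * k = k * s + k" by simp
  ultimately show "k * s + s \<le> n" "Suc s * k \<le> n" "s + k \<le> n" "2 \<le> n" by linarith+
qed

text \<open>This is what remains of the estimate for small families once all counts are expressed
  through the star size. The bound on \<open>n\<close> enters through the slack \<open>y\<close>:
  after substitution the difference is a sum of nonnegative terms.\<close>

lemma core_numeric:
  fixes n k s u q :: real
  assumes k: "k \<ge> 1" and s: "s > 0" and n: "n \<ge> 4 * k\<^sup>2 * s" and u: "0 \<le> u" "u \<le> s"
    and q: "q \<ge> n / k - s"
  shows "q * (3 * k * s * (k - 1/2)) + s * k * n + u * n \<le> (q + u) * (n - s * (k - 1))"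
proof -
  define y where "y = n - 4 * k\<^sup>2 * s"
  \<comment> \<open>The claim is equivalent to
    \<open>s * k * n + u * s * (k - 1) \<le> q * z\<close>, and \<open>k * q\<close> is at least
    \<open>n - k * s\<close>.\<close>
  define z where "z = n - s * (k - 1) - 3 * k * s * (k - 1/2)"
  have y: "y \<ge> 0" "n = 4 * k\<^sup>2 * s + y" using n by (auto simp: y_def)
  have z: "z = k\<^sup>2 * s + k * s / 2 + s + y" by (simp add: z_def y(2) power2_eq_square field_simps)
  then have z0: "z \<ge> 0" using k s y by simp
  have "(n - k * s) * z - (s * k\<^sup>2 * n + s * s * k * (k - 1))
      = y * y + y * s * (4 * k\<^sup>2 - k / 2 + 1) + s * s * (k ^ 3 + 5 / 2 * k\<^sup>2)"
    unfolding z y(2) by (simp add: field_simps power2_eq_square power3_eq_cube)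
  moreover have "4 * k\<^sup>2 - k / 2 + 1 \<ge> 0" using k self_le_power[of k 2] by simp
  then have "y * s * (4 * k\<^sup>2 - k / 2 + 1) \<ge> 0" using y s by simp
  moreover have "y * y \<ge> 0" "s * s * (k ^ 3 + 5 / 2 * k\<^sup>2) \<ge> 0" using k s by simp_all
  ultimately have "(n - k * s) * z \<ge> s * k\<^sup>2 * n + s * s * k * (k - 1)" by linarith
  moreover have "k * q \<ge> n - k * s" using q k by (simp add: field_simps)
  then have "(n - k * s) * z \<le> k * q * z" using z0 by (rule mult_right_mono)
  moreover have "s * s * k * (k - 1) \<ge> u * s * k * (k - 1)"
    using u k s by (intro mult_right_mono) auto
  ultimately have "k * (s * k * n + u * s * (k - 1)) \<le> k * (q * z)"
    by (simp add: power2_eq_square algebra_simps)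
  then have "s * k * n + u * s * (k - 1) \<le> q * z" using k by simp
  then show ?thesis by (simp add: z_def algebra_simps)
qed

text \<open>With \<open>E\<close> for the number of sets meeting \<open>H\<close>, each
  \<open>B j\<close> has at most \<open>E\<close> members besides those of \<open>B' j\<close>. The
  total of these leftovers is bounded by a multiple of \<open>d = u - h\<close>. The number of sets
  meeting \<open>u\<close> points exceeds \<open>E\<close> by at least \<open>d * A\<close>, so
  \<open>d\<close> factors out and a numerical inequality is left.\<close>

lemma weight_bound_small_families:
  fixes B :: "nat \<Rightarrow> 'a set set" and q :: real
  assumes n_def: "n = card V"
    and V: "finite V" and k: "k > 0" and us: "u \<le> s" "s > 0" and n: "n \<ge> 4 * k\<^sup>2 * s"
    and B: "\<And>j. j \<le> u \<Longrightarrow> B j \<subseteq> subsets_of_card V k"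
    and nested: "\<And>i j. i \<le> j \<Longrightarrow> j \<le> u \<Longrightarrow> B i \<subseteq> B j"
    and no: "\<not> rainbow {..u} B"
    and small: "card (B u) \<le> s * k * star_size n k"
    and q: "q \<ge> real n / real k - real s"
  shows "q * real (card (B 0)) + (\<Sum>j=1..u. real (card (B j)))
    \<le> (q + real u) * (real (n choose k) - real ((n - u) choose k))"
proof -
  let ?C = "star_size n k" and ?c = "star_size (n - 1) (k - 1)"
  have ks: "k * s + s \<le> n" "Suc s * k \<le> n" "n > 0"
    using size_bounds[OF k us(2) n] by auto
  \<comment> \<open>The threshold uses \<open>s\<close> instead of \<open>u\<close> to fit the
    bounded-degree lemma. It is high enough to delete \<open>H\<close> because
    \<open>u \<le> s\<close>.\<close>
  define H where "H = {x \<in> V. card {A \<in> B 0. x \<in> A} > k * s * ?c}"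
  define h where "h = card H"
  define B' where "B' j = {A \<in> B j. A \<inter> H = {}}" for j
  have "k * u * ?c \<le> k * s * ?c" using us by (intro mult_le_mono1 mult_le_mono2)
  then have high: "card {A \<in> B 0. x \<in> A} > k * u * star_size (card V - 1) (k - 1)" if "x \<in> H" for x
    using that unfolding H_def n_def by (metis (no_types, lifting) le_less_trans mem_Collect_eq)
  have HV: "H \<subseteq> V" by (auto simp: H_def)
  have B'_eq: "B' = (\<lambda>j. {A \<in> B j. A \<inter> H = {}})" by (simp add: B'_def fun_eq_iff)
  have hu: "h \<le> u" and no': "\<not> rainbow {h..u} B'"
    using delete_high_degree[OF V k B _ no HV high] nested unfolding h_def B'_eq by blast+
  have B'V: "B' j \<subseteq> subsets_of_card V k" if "j \<le> u" for j using B[OF that] by (auto simp: B'_def)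
  have fin: "finite (B j)" if "j \<le> u" for j using finite_subset[OF B[OF that]] V by simp
  have nested': "B' i \<subseteq> B' j" if "i \<le> j" "j \<le> u" for i j using nested[OF that] by (auto simp: B'_def)
  have crd: "card {h..u} = Suc (u - h)" using hu by simp
  have le: "card {h..u} * k \<le> card V"
  proof -
    have "Suc (u - h) * k \<le> Suc s * k" using us by (intro mult_le_mono1) simp
    then have "Suc (u - h) * k \<le> n" using ks(2) by (rule le_trans)
    then show ?thesis unfolding crd n_def .
  qed
  \<comment> \<open>For \<open>i \<le> h\<close> all of \<open>B' h, ..., B' u\<close> contain
    \<open>B' i\<close>, so copies of \<open>B' i\<close> cannot be matched either.\<close>
  have noh: "\<not> rainbow {h..u} (\<lambda>_. B' i)" if "i \<le> h" for i
  proof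
    assume "rainbow {h..u} (\<lambda>_. B' i)"
    then have "rainbow {h..u} B'" using nested' that by (elim rainbow_mono) auto
    then show False using no' by simp
  qed
  have b0: "card (B' 0) \<le> 3 * k * s * (u - h) * ?c"
  proof -
    have "card {A \<in> B' 0. x \<in> A} \<le> k * s * ?c" if "x \<in> V" for x
    proof (cases "x \<in> H")
      case True
      then have "{A \<in> B' 0. x \<in> A} = {}" by (auto simp: B'_def)
      then show ?thesis by (simp only: card.empty)
    next
      case False
      then have "card {A \<in> B 0. x \<in> A} \<le> k * s * ?c" using that by (auto simp: H_def)
      moreover have "card {A \<in> B' 0. x \<in> A} \<le> card {A \<in> B 0. x \<in> A}"
        using fin[of 0] by (intro card_mono) (auto simp: B'_def)
      ultimately show ?thesis by simp
    qed
    then show ?thesis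
      using card_le_of_bounded_degree[of "{h..u}" V "B' 0" k s] V B'V[of 0] noh[of 0] k le us crd
      by (simp add: n_def)
  qed
  have bh: "card (B' h) \<le> (u - h) * ?C"
    using card_le_of_no_rainbow[of "{h..u}" V "B' h" k] V B'V[OF hu] noh[of h] le crd by (simp add: n_def)
  have bj: "card (B' j) \<le> s * k * ?C" if "j \<le> u" for j
  proof -
    have "card (B' j) \<le> card (B u)"
      using nested[OF that] fin[of u] by (intro card_mono) (auto simp: B'_def)
    then show ?thesis using small by simp
  qed
  \<comment> \<open>The families up to \<open>B' h\<close> are bounded through copies of
    \<open>B' h\<close>, the other \<open>u - h\<close> only by the smallness of
    \<open>B u\<close>.\<close>
  have sumB': "(\<Sum>j=1..u. card (B' j)) \<le> h * ((u - h) * ?C) + (u - h) * (s * k * ?C)"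
  proof -
    have "{1..u} = {1..h} \<union> {h + 1..u}" using hu by auto
    then have "(\<Sum>j=1..u. card (B' j)) = (\<Sum>j\<in>{1..h} \<union> {h + 1..u}. card (B' j))" by simp
    also have "\<dots> = (\<Sum>j=1..h. card (B' j)) + (\<Sum>j=h+1..u. card (B' j))"
      by (rule sum.union_disjoint) auto
    also have "(\<Sum>j=1..h. card (B' j)) \<le> card {1..h} * ((u - h) * ?C)"
    proof (rule sum_bounded_above[of _ _ "(u - h) * ?C", simplified of_nat_id])
      fix j assume "j \<in> {1..h}"
      then have "card (B' j) \<le> card (B' h)"
        using nested'[of j h] hu fin[of h] by (intro card_mono) (auto simp: B'_def)
      then show "card (B' j) \<le> (u - h) * ?C" using bh by simp
    qed
    also have "(\<Sum>j=h+1..u. card (B' j)) \<le> card {h+1..u} * (s * k * ?C)"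
      by (rule sum_bounded_above[of _ _ "s * k * ?C", simplified of_nat_id]) (use bj in auto)
    finally show ?thesis by simp
  qed
  define E where "E = real (n choose k) - real ((n - h) choose k)"
  have split: "real (card (B j)) \<le> E + real (card (B' j))" if "j \<le> u" for j
  proof -
    have "B j = {A \<in> B j. A \<inter> H \<noteq> {}} \<union> B' j" by (auto simp: B'_def)
    then have "card (B j) \<le> card {A \<in> B j. A \<inter> H \<noteq> {}} + card (B' j)" by (metis card_Un_le)
    moreover have "card {A \<in> B j. A \<inter> H \<noteq> {}} \<le> card {A \<in> subsets_of_card V k. A \<inter> H \<noteq> {}}"
      using V B[OF that] by (intro card_mono) auto
    moreover have "real (card {A \<in> subsets_of_card V k. A \<inter> H \<noteq> {}}) = E"
      unfolding E_def n_def h_def by (rule card_meeting[OF V HV])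
    ultimately show ?thesis by linarith
  qed
  have q0: "q \<ge> 0"
  proof -
    have "real (k * s) \<le> real n" using ks(1) by (simp only: of_nat_le_iff)
    then have "real s \<le> real n / real k" using k by (simp add: field_simps)
    then show ?thesis using q by linarith
  qed
  define d where "d = real (u - h)"
  define C c A where "C = real ?C" and "c = real ?c" and "A = real ((n - s) choose (k - 1))"
  have nn: "C \<ge> 0" "c \<ge> 0" "d \<ge> 0" by (auto simp: C_def c_def d_def)
  have "q * real (card (B 0)) + (\<Sum>j=1..u. real (card (B j)))
      \<le> q * (E + real (card (B' 0))) + (\<Sum>j=1..u. E + real (card (B' j)))"
    using split q0 by (intro add_mono mult_left_mono sum_mono) auto
  also have "\<dots> = (q + u) * E + q * real (card (B' 0)) + real (\<Sum>j=1..u. card (B' j))"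
    by (simp add: sum.distrib algebra_simps)
  also have "\<dots> \<le> (q + u) * E + q * (3 * k * s * d * c) + (u * (d * C) + d * (s * k * C))"
  proof (intro add_mono mult_left_mono q0 order_refl)
    have "real (card (B' 0)) \<le> real (3 * k * s * (u - h) * ?c)" using b0 by (simp only: of_nat_le_iff)
    then show "real (card (B' 0)) \<le> 3 * k * s * d * c" by (simp add: d_def c_def)
    have "(\<Sum>j=1..u. card (B' j)) \<le> u * ((u - h) * ?C) + (u - h) * (s * k * ?C)"
      using sumB' mult_le_mono1[OF hu, of "(u - h) * ?C"] by linarith
    then have "real (\<Sum>j=1..u. card (B' j)) \<le> real (u * ((u - h) * ?C) + (u - h) * (s * k * ?C))"
      by (simp only: of_nat_le_iff)
    then show "real (\<Sum>j=1..u. card (B' j)) \<le> u * (d * C) + d * (s * k * C)"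
      by (simp add: d_def C_def)
  qed (use q0 in simp)
  also have "\<dots> = (q + u) * E + d * (q * (3 * k * s) * c + u * C + s * k * C)"
    by (simp add: algebra_simps)
  \<comment> \<open>It suffices to compare the factors of \<open>d\<close>. Multiplied by
    \<open>n\<close>, both are estimated by multiples of \<open>C\<close>, which leaves the
    numerical inequality \<open>core_numeric\<close>.\<close>
  also have "\<dots> \<le> (q + u) * E + d * ((q + u) * A)"
  proof (intro add_mono mult_left_mono order_refl nn)
    have "(n - 1) * ?c = (k - 1) * ?C"
      using star_size_absorb[of "n - 1" "k - 1"] k by (simp add: star_size_def)
    then have nc: "(real n - 1) * c = (real k - 1) * C"
      unfolding c_def C_def using ks(3) k
      by (metis One_nat_def Suc_leI of_nat_1 of_nat_diff of_nat_mult)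
    have sn: "real s \<le> real n" using ks(1) by simp
    have "2 * k \<le> Suc s * k" using us(2) by (intro mult_le_mono1) simp
    then have "2 * k \<le> n" using ks(2) by linarith
    then have kn: "2 * real k \<le> real n" by linarith
    then have n1: "real n - 1 > 0" using k by linarith
    \<comment> \<open>The exact factor \<open>n * (k - 1) / (n - 1)\<close> is at most
      \<open>k - 1/2\<close> because \<open>2 * k \<le> n\<close>.\<close>
    have c: "n * c \<le> (real k - 1/2) * C"
    proof -
      have "(real n - 1) * (n * c) = n * ((real n - 1) * c)" by simp
      also have "\<dots> = n * (real k - 1) * C" by (simp only: nc mult.assoc)
      also have "\<dots> \<le> (real n - 1) * (real k - 1/2) * C"
        using kn n1 nn by (intro mult_right_mono) (auto simp: field_simps)
      finally show ?thesis using n1 by (simp add: mult.assoc)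
    qed
    \<comment> \<open>Passing from \<open>C\<close> to \<open>A\<close> loses at most
      \<open>(s - 1) * c\<close>, and \<open>n * (s - 1) * c\<close> is at most
      \<open>s * (k - 1) * C\<close> because \<open>s \<le> n\<close>.\<close>
    have A: "n * A \<ge> (n - real s * (real k - 1)) * C"
    proof -
      have "(real n - 1) * ((real s - 1) * (n * c)) = (real s - 1) * n * ((real n - 1) * c)"
        by (simp add: algebra_simps)
      also have "\<dots> = (real s - 1) * n * ((real k - 1) * C)" by (simp only: nc)
      also have "\<dots> \<le> real s * (real n - 1) * ((real k - 1) * C)"
        using sn nn k by (intro mult_right_mono mult_nonneg_nonneg) (auto simp: algebra_simps)
      also have "\<dots> = (real n - 1) * (real s * ((real k - 1) * C))" by simp
      finally have "(real s - 1) * (n * c) \<le> real s * ((real k - 1) * C)" using n1 by simp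
      moreover have "C - A \<le> (real s - 1) * c"
        using star_size_diff_le[of s n k] us k sn by (simp add: A_def C_def c_def of_nat_diff)
      then have "real n * (C - A) \<le> real n * ((real s - 1) * c)" by (intro mult_left_mono) auto
      ultimately show ?thesis by (simp add: algebra_simps)
    qed
    have "real n * (q * (3 * k * s) * c + u * C + s * k * C)
        = q * (3 * k * s) * (n * c) + (u * n + s * k * n) * C" by (simp add: algebra_simps)
    also have "\<dots> \<le> q * (3 * k * s) * ((real k - 1/2) * C) + (u * n + s * k * n) * C"
      using c q0 by (intro add_mono mult_left_mono) auto
    also have "\<dots> = (q * (3 * k * s * (real k - 1/2)) + s * k * n + u * n) * C" by (simp add: algebra_simps)
    also have "\<dots> \<le> ((q + u) * (n - s * (real k - 1))) * C"
    proof (rule mult_right_mono[OF _ nn(1)])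
      have "real (4 * k\<^sup>2 * s) \<le> real n" using n by (simp only: of_nat_le_iff)
      then show "q * (3 * k * s * (real k - 1/2)) + s * k * n + u * n \<le> (q + u) * (n - s * (real k - 1))"
        using core_numeric[where n = n and k = k and s = s and u = u and q = q] k us q by simp
    qed
    also have "\<dots> \<le> (q + u) * (n * A)"
      using q0 unfolding mult.assoc by (intro mult_left_mono A) simp
    finally have "real n * (q * (3 * k * s) * c + u * C + s * k * C) \<le> real n * ((q + u) * A)"
      by (simp add: algebra_simps)
    then show "q * (3 * k * s) * c + u * C + s * k * C \<le> (q + u) * A" using ks(3) by simp
  qed (use q0 in simp)
  also have "\<dots> = (q + u) * (E + d * A)" by (simp add: algebra_simps)
  also have "\<dots> \<le> (q + u) * (real (n choose k) - real ((n - u) choose k))"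
  proof (rule mult_left_mono)
    have "s \<le> n" using ks(1) by simp
    then show "E + d * A \<le> real (n choose k) - real ((n - u) choose k)"
      using binomial_diff_ge[OF hu us(1) _ k] unfolding E_def d_def A_def by fastforce
  qed (use q0 in simp)
  finally show ?thesis .
qed

section \<open>The weight of overlapping families\<close>

text \<open>This is the comparison \<open>(q + u) * E u + (s - u) * m \<le> s * m\<close> with the
  critical \<open>q\<close> eliminated through \<open>(q + s) * E s = s * m\<close>. As
  \<open>E\<close> is nearly linear, \<open>s * E u - u * E s\<close> is at most
  \<open>d * u * (s - 1) * c\<close>; by \<open>key\<close>, \<open>m\<close> times this is
  outweighed by \<open>d * E u * E s\<close>.\<close>

lemma intermediate_value_le:
  fixes n k s :: nat
  defines "E \<equiv> \<lambda>j. real (n choose k) - real ((n - j) choose k)"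
  assumes k: "k > 0" and s: "s > 0" and u: "u \<le> s" and n: "n \<ge> 4 * k\<^sup>2 * s"
  shows "real s * real (n choose k) * E u \<le> (real u * real (n choose k) + real (s - u) * E u) * E s"
proof -
  define m C c A d where "m = real (n choose k)" and "C = real (star_size n k)"
    and "c = real (star_size (n - 1) (k - 1))" and "A = real ((n - s) choose (k - 1))"
    and "d = real (s - u)"
  have nn: "m \<ge> 0" "C \<ge> 0" "c \<ge> 0" "A \<ge> 0" "d \<ge> 0" by (auto simp: m_def C_def c_def A_def d_def)
  have sn: "s \<le> n" "n \<ge> 2" using size_bounds[OF k s n] by auto
  have dd: "d = real s - real u" using u by (simp add: d_def of_nat_diff)
  have Eu: "E u \<ge> u * A" "E u \<le> u * C"
    using binomial_diff_ge[of 0 u s n k] binomial_diff_le[of u n k] u sn k by (simp_all add: E_def A_def C_def)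
  have Es: "E s \<ge> s * A"
    using binomial_diff_ge[of 0 s s n k] sn k by (simp add: E_def A_def)
  have Esu: "E s - E u \<ge> d * A"
    using binomial_diff_ge[of u s s n k] sn k u by (simp add: E_def A_def d_def)
  have CA: "C - A \<le> (real s - 1) * c"
    using star_size_diff_le[of s n k] s sn k by (simp add: C_def A_def c_def of_nat_diff)
  have key: "m * ((real s - 1) * c) \<le> s * (A * A)"
  proof -
    define t where "t = (real s - 1) * c"
    have nC: "k * m = n * C"
      unfolding m_def C_def using star_size_absorb[of n k] by (metis of_nat_mult)
    have "(n - 1) * star_size (n - 1) (k - 1) = (k - 1) * star_size n k"
      using star_size_absorb[of "n - 1" "k - 1"] k by (simp add: star_size_def)
    then have "real (n - 1) * c = real (k - 1) * C"
      unfolding c_def C_def by (metis of_nat_mult)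
    then have nc: "(real n - 1) * c = (real k - 1) * C" using sn k by (simp add: of_nat_diff)
    have "(real n - 1) * t = (real s - 1) * ((real n - 1) * c)" by (simp add: t_def)
    then have nt: "(real n - 1) * t = (real s - 1) * ((real k - 1) * C)" by (simp only: nc)
    have "real (4 * k\<^sup>2 * s) \<le> real n" using n by (simp only: of_nat_le_iff)
    then have rn: "4 * (real k)\<^sup>2 * real s \<le> real n" by simp
    \<comment> \<open>Multiplying \<open>m * t \<le> s * (C * C - 2 * C * t)\<close> by
      \<open>k * (n - 1)\<close> turns both sides into multiples of \<open>C * C\<close>;
      \<open>b\<close> is the right coefficient minus the left one.\<close>
    define b where "b = real n * (real k + real s - 1) - k * s - 2 * k * s * (real s - 1) * (real k - 1)"
    have "b \<ge> 0"
    proof -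
      have "2 * k * s * (real s - 1) * (real k - 1) \<le> 2 * k * s * (real s - 1) * (2 * k)"
        using s k by (intro mult_left_mono) auto
      also have "\<dots> = (4 * (real k)\<^sup>2 * real s) * (real s - 1)" by (simp add: power2_eq_square)
      also have "\<dots> \<le> n * (real s - 1)" using rn s by (intro mult_right_mono) auto
      finally have "2 * k * s * (real s - 1) * (real k - 1) \<le> n * (real s - 1)" .
      moreover have "real k * s \<le> real k * n" using sn by (intro mult_left_mono) auto
      ultimately show ?thesis by (simp add: b_def algebra_simps)
    qed
    then have "b * (C * C) \<ge> 0" by simp
    have "k * ((real n - 1) * (m * t)) = (k * m) * ((real n - 1) * t)" by simp
    also have "\<dots> = n * (real s - 1) * (real k - 1) * (C * C)" unfolding nC nt by simp
    also have "\<dots> \<le> n * (real s - 1) * (real k - 1) * (C * C) + b * (C * C)"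
      using \<open>b * (C * C) \<ge> 0\<close> by simp
    also have "\<dots> = k * (s * ((real n - 1) * (C * C) - 2 * C * ((real s - 1) * ((real k - 1) * C))))"
      by (simp add: b_def algebra_simps)
    also have "\<dots> = k * ((real n - 1) * (s * (C * C - 2 * C * t)))"
      unfolding nt[symmetric] by (simp add: algebra_simps)
    finally have "m * t \<le> s * (C * C - 2 * C * t)" using k sn by simp
    \<comment> \<open>Expanding \<open>(A - C) * (A - C) \<ge> 0\<close> gives
      \<open>A * A \<ge> 2 * C * A - C * C\<close>. So \<open>A \<ge> C - t\<close> enters only
      linearly, whatever the sign of \<open>C - t\<close>.\<close>
    also have "C * C - 2 * C * t \<le> A * A"
    proof -
      have "C * (C - t) \<le> C * A" using CA nn by (intro mult_left_mono) (auto simp: t_def)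
      moreover have "0 \<le> (A - C) * (A - C)" by simp
      ultimately show ?thesis by (simp add: algebra_simps)
    qed
    finally show ?thesis by (simp add: t_def mult_left_mono)
  qed
  have "s * E u - u * E s = d * E u - u * (E s - E u)" by (simp add: dd algebra_simps)
  also have "\<dots> \<le> d * (u * C) - u * (d * A)"
    using Eu(2) Esu nn by (intro diff_mono mult_left_mono) auto
  also have "\<dots> = d * u * (C - A)" by (simp add: algebra_simps)
  also have "\<dots> \<le> d * u * ((real s - 1) * c)" using CA nn by (intro mult_left_mono) auto
  finally have "m * (s * E u - u * E s) \<le> m * (d * u * ((real s - 1) * c))"
    using nn by (intro mult_left_mono) auto
  also have "\<dots> = d * u * (m * ((real s - 1) * c))" by simp
  also have "\<dots> \<le> d * u * (s * (A * A))" using key nn by (intro mult_left_mono) auto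
  also have "\<dots> = d * ((u * A) * (s * A))" by simp
  also have "\<dots> \<le> d * (E u * E s)"
    using Eu(1) Es nn by (intro mult_left_mono mult_mono order_trans[OF _ Eu(1)]) auto
  finally show ?thesis by (simp add: m_def d_def algebra_simps)
qed

text \<open>Otherwise the prefix up to the last small family, if there is one, has a rainbow
  matching. Its restriction serves all small families, and the large ones are matched greedily
  afterwards.\<close>

lemma ex_small_overlapping_prefix:
  fixes B :: "nat \<Rightarrow> 'a set set"
  assumes V: "finite V"
    and B: "\<And>j. j \<le> s \<Longrightarrow> B j \<subseteq> subsets_of_card V k"
    and no: "\<not> rainbow {..s} B"
  shows "\<exists>u\<le>s. card (B u) \<le> s * k * star_size (card V) k \<and> \<not> rainbow {..u} B"
proof (rule ccontr)
  let ?b = "s * k * star_size (card V) k"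
  assume "\<not> ?thesis"
  then have all: "rainbow {..u} B" if "u \<le> s" "card (B u) \<le> ?b" for u using that by blast
  define J where "J = {j \<in> {..s}. card (B j) > ?b}"
  have "\<exists>A. (\<forall>i\<in>{..s} - J. A i \<in> B i) \<and> disjoint_family_on A ({..s} - J)"
  proof (cases "{..s} - J = {}")
    case False
    define u where "u = Max ({..s} - J)"
    have "u \<in> {..s} - J" unfolding u_def using False by (intro Max_in) auto
    then have "rainbow {..u} B" by (intro all) (auto simp: J_def)
    moreover have "{..s} - J \<subseteq> {..u}" by (auto simp: u_def)
    ultimately show ?thesis unfolding rainbow_def by (meson disjoint_family_on_mono subsetD)
  next
    case True
    then show ?thesis by (simp only: True) (simp add: disjoint_family_on_def)
  qed
  then obtain A where A: "\<And>i. i \<in> {..s} - J \<Longrightarrow> A i \<in> B i" "disjoint_family_on A ({..s} - J)"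
    by blast
  have "rainbow {..s} B"
  \<comment> \<open>Large families reserve no points: at most \<open>s * k\<close> points are in the
    way, and these meet too few sets to exhaust such a family.\<close>
  proof (rule rainbow_extend[of "{..s}" J V B k "\<lambda>_. {}" A])
    fix j Z assume j: "j \<in> J" and Z: "Z \<subseteq> V" "card Z \<le> k * (card {..s} - 1)"
    have "card {A \<in> B j. A \<inter> Z \<noteq> {}} \<le> card Z * star_size (card V) k"
      using B j Z V by (intro card_meeting_le) (auto simp: J_def)
    also have "\<dots> \<le> ?b" using Z(2) by (intro mult_le_mono1) (simp add: mult.commute)
    also have "\<dots> < card (B j)" using j by (simp add: J_def)
    finally have "{A \<in> B j. A \<inter> Z \<noteq> {}} \<noteq> B j" by (metis less_irrefl)
    then show "\<exists>A\<in>B j. A \<inter> Z = {}" by blast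
  qed (use V B A in \<open>auto simp: J_def disjoint_family_on_def\<close>)
  then show False using no by simp
qed

lemma weight_upper_bound:
  fixes B :: "nat \<Rightarrow> 'a set set" and p :: real
  assumes n_def: "n = card V"
    and V: "finite V" and k: "k > 0" and s: "s > 0" and n: "n \<ge> 4 * k\<^sup>2 * s"
    and B: "\<And>j. j \<le> s \<Longrightarrow> B j \<subseteq> subsets_of_card V k"
    and nested: "\<And>i j. i \<le> j \<Longrightarrow> j \<le> s \<Longrightarrow> B i \<subseteq> B j"
    and no: "\<not> rainbow {..s} B"
  shows "p * real (card (B 0)) + (\<Sum>j=1..s. real (card (B j)))
    \<le> max (real s * real (n choose k)) ((p + real s) * (real (n choose k) - real ((n - s) choose k)))"
proof -
  define m where "m = real (n choose k)"
  define E where "E j = real (n choose k) - real ((n - j) choose k)" for j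
  obtain u where u: "u \<le> s" "card (B u) \<le> s * k * star_size n k" "\<not> rainbow {..u} B"
    using ex_small_overlapping_prefix[OF V B no] n_def by blast
  have sn: "s + k \<le> n" "n > 0" using size_bounds[OF k s n] by auto
  have Epos: "E s > 0"
  proof -
    have "real (s - 0) * real ((n - s) choose (k - 1)) > 0" using s sn by simp
    then show ?thesis using binomial_diff_ge[of 0 s s n k] sn k unfolding E_def by fastforce
  qed
  \<comment> \<open>The weight at which the two terms of the maximum coincide.\<close>
  define q where "q = s * m / E s - s"
  have qE: "(q + s) * E s = s * m" using Epos by (simp add: q_def)
  \<comment> \<open>The bound \<open>E s \<le> s * star_size n k\<close> and the identity
    \<open>n * star_size n k = k * m\<close> put \<open>q\<close> in the range of the bound for
    small families.\<close>
  have q: "q \<ge> real n / real k - real s"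
  proof -
    have "E s \<le> s * real (star_size n k)"
      using binomial_diff_le[of s n k] sn k by (simp add: E_def)
    then have "n * E s \<le> n * (s * real (star_size n k))" by (intro mult_left_mono) auto
    also have "\<dots> = s * real (n * star_size n k)" by simp
    also have "\<dots> = s * real k * m" by (simp add: star_size_absorb m_def)
    finally have "n / k \<le> s * m / E s" using Epos k by (simp add: field_simps)
    then show ?thesis by (simp add: q_def)
  qed
  have core: "r * real (card (B 0)) + (\<Sum>j=1..u. real (card (B j))) \<le> (r + u) * E u" if "r \<ge> q" for r
    unfolding E_def
    by (rule weight_bound_small_families[OF n_def V k u(1) s n _ _ u(3,2)])
      (use B nested u(1) q that in auto)
  have tail: "(\<Sum>j=1..s. real (card (B j))) \<le> (\<Sum>j=1..u. real (card (B j))) + (s - u) * m"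
  proof -
    have "{1..s} = {1..u} \<union> {u + 1..s}" using u(1) by auto
    then have "(\<Sum>j=1..s. real (card (B j))) = (\<Sum>j\<in>{1..u} \<union> {u + 1..s}. real (card (B j)))" by simp
    also have "\<dots> = (\<Sum>j=1..u. real (card (B j))) + (\<Sum>j=u+1..s. real (card (B j)))"
      by (rule sum.union_disjoint) auto
    also have "(\<Sum>j=u+1..s. real (card (B j))) \<le> of_nat (card {u+1..s}) * m"
    proof (rule sum_bounded_above)
      fix j assume "j \<in> {u+1..s}"
      then have "card (B j) \<le> card (subsets_of_card V k)" using B[of j] V by (intro card_mono) auto
      then show "real (card (B j)) \<le> m" by (simp add: m_def n_def card_subsets_of_card[OF V])
    qed
    finally show ?thesis by simp
  qed
  have crit: "(q + u) * E u + (s - u) * m \<le> s * m"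
  proof -
    have "(s * m * E u) \<le> (u * m + real (s - u) * E u) * E s"
      unfolding m_def E_def by (rule intermediate_value_le[OF k s u(1) n])
    moreover have "(q + s) * E u * E s = ((q + s) * E s) * E u" by simp
    ultimately have "(q + s) * E u * E s \<le> (u * m + real (s - u) * E u) * E s"
      by (simp only: qE)
    then have "(q + s) * E u \<le> u * m + real (s - u) * E u" using Epos by simp
    then show ?thesis using u(1) by (simp add: of_nat_diff algebra_simps)
  qed
  show ?thesis
  proof (cases "p \<le> q")
    case True
    then have "p * real (card (B 0)) \<le> q * real (card (B 0))" by (intro mult_right_mono) auto
    then show ?thesis using core[of q] tail crit unfolding m_def by linarith
  next
    case False
    have "E u \<le> E s" unfolding E_def using u(1) by (simp add: binomial_right_mono)
    then have "(p - q) * E u \<le> (p - q) * E s" using False by (intro mult_left_mono) auto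
    moreover have "(p + u) * E u = (q + u) * E u + (p - q) * E u" "(p + s) * E s = (q + s) * E s + (p - q) * E s"
      by (simp_all add: algebra_simps)
    ultimately have "p * real (card (B 0)) + (\<Sum>j=1..s. real (card (B j))) \<le> (p + s) * E s"
      using core[of p] tail crit qE False by linarith
    then show ?thesis by (simp add: E_def)
  qed
qed

section \<open>Extremal configurations and the final equality\<close>

lemma overlapping_iff_not_rainbow: "overlapping s B \<longleftrightarrow> \<not> rainbow {..s} B"
  by (simp add: overlapping_iff rainbow_def atLeast0AtMost)

text \<open>Pigeonhole: \<open>s + 1\<close> disjoint sets meeting \<open>S\<close> would give
  \<open>s + 1\<close> distinct points of \<open>S\<close>.\<close>

lemma overlapping_trace:
  assumes "finite S" "card S \<le> s" "\<And>i A. i \<le> s \<Longrightarrow> A \<in> B i \<Longrightarrow> A \<inter> S \<noteq> {}"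
  shows "overlapping s B"
  unfolding overlapping_iff_not_rainbow
proof
  assume "rainbow {..s} B"
  then obtain A where A: "\<And>i. i \<le> s \<Longrightarrow> A i \<in> B i" "disjoint_family_on A {..s}"
    unfolding rainbow_def by auto
  then have "\<exists>x. x \<in> A i \<inter> S" if "i \<le> s" for i using assms(3)[OF that A(1)[OF that]] by blast
  then obtain x where x: "\<And>i. i \<le> s \<Longrightarrow> x i \<in> A i \<inter> S" by metis
  have "inj_on x {..s}"
  proof (rule inj_onI)
    fix i j assume ij: "i \<in> {..s}" "j \<in> {..s}" "x i = x j"
    then have "x i \<in> A i \<inter> A j" using x[of i] x[of j] by simp
    then show "i = j" using disjoint_family_onD[OF A(2) ij(1,2)] by blast
  qed
  then have "card {..s} \<le> card S" using x assms(1) by (intro card_inj_on_le) auto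
  then show False using assms(2) by simp
qed

theorem theorem1p4:
  fixes n k s p :: nat
  assumes "n > 0" and "k > 0" and "s > 0" and "p > 0"
    and "n \<ge> 4 * k\<^sup>2 * s"
  shows "max_weight (\<lambda>i. if i = 0 then real p else 1) n k s =
    max (real s * real (n choose k))
        (real (p + s) * (real (n choose k) - real ((n - s) choose k)))"
proof -
  let ?V = "{1..n}" and ?w = "\<lambda>i::nat. if i = 0 then real p else 1"
  have V: "k_subsets n k = subsets_of_card ?V k" by (simp add: k_subsets_def subsets_of_card_def)
  have weight: "(\<Sum>i=0..s. ?w i * real (card (B i)))
      = real p * real (card (B 0)) + (\<Sum>j=1..s. real (card (B j)))" for B :: "nat \<Rightarrow> nat set set"
    by (simp add: sum.atLeast_Suc_atMost)
  have sn: "s \<le> n" using size_bounds[OF assms(2,3,5)] by simp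
  let ?S = "{(\<Sum>i=0..s. ?w i * real (card (B i))) | B.
      (\<forall>i<s. B i \<subseteq> B (Suc i)) \<and> B s \<subseteq> k_subsets n k \<and> overlapping s B}"
  have "Max ?S = max (real s * real (n choose k))
        (real (p + s) * (real (n choose k) - real ((n - s) choose k)))" (is "_ = ?R")
  proof (rule antisym)
    show "Max ?S \<le> ?R"
    proof (subst Max_le_iff[OF weights_finite weights_nonempty], safe)
      fix B :: "nat \<Rightarrow> nat set set"
      assume B: "\<forall>i<s. B i \<subseteq> B (Suc i)" "B s \<subseteq> k_subsets n k" "overlapping s B"
      have nested: "B i \<subseteq> B j" if "i \<le> j" "j \<le> s" for i j
        using that
      proof (induction j rule: dec_induct)
        case (step j)
        then have "B i \<subseteq> B j" "B j \<subseteq> B (Suc j)" using B(1) by auto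
        then show ?case by simp
      qed simp
      then show "(\<Sum>i=0..s. ?w i * real (card (B i))) \<le> ?R"
        unfolding weight of_nat_add
        using B assms by (intro weight_upper_bound[of n ?V]) (auto simp: V overlapping_iff_not_rainbow)
    qed
    have ge: "(\<Sum>i=0..s. ?w i * real (card (B i))) \<le> Max ?S"
      if "\<forall>i<s. B i \<subseteq> B (Suc i)" "B s \<subseteq> k_subsets n k" "overlapping s B" for B
      by (rule Max_ge[OF weights_finite]) (use that in blast)
    \<comment> \<open>The first extremal configuration: an empty family blocks every rainbow
      matching, and the other \<open>s\<close> families are full.\<close>
    let ?B1 = "\<lambda>i::nat. if i = 0 then {} else k_subsets n k"
    have "overlapping s ?B1"
      unfolding overlapping_iff_not_rainbow rainbow_def by (auto intro!: bexI[of _ 0])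
    then have "(\<Sum>i=0..s. ?w i * real (card (?B1 i))) \<le> Max ?S" by (intro ge) auto
    moreover have "(\<Sum>i=0..s. ?w i * real (card (?B1 i))) = real s * real (n choose k)"
      unfolding weight by (simp add: V card_subsets_of_card)
    moreover
    \<comment> \<open>The second extremal configuration: all families consist of the sets meeting a
      fixed \<open>s\<close>-set, so the weight is \<open>p + s\<close> times their number.\<close>
    let ?B2 = "\<lambda>i::nat. {A \<in> subsets_of_card ?V k. A \<inter> {1..s} \<noteq> {}}"
    have c: "real (card (?B2 0)) = real (n choose k) - real ((n - s) choose k)"
      using card_meeting[of ?V "{1..s}" k] sn by simp
    have "(\<Sum>i=0..s. ?w i * real (card (?B2 i))) \<le> Max ?S"
      by (rule ge) (auto simp: V intro!: overlapping_trace[of "{1..s}"])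
    moreover have "(\<Sum>i=0..s. ?w i * real (card (?B2 i)))
        = real (p + s) * (real (n choose k) - real ((n - s) choose k))"
      using weight[of ?B2] by (simp add: c ring_distribs del: One_nat_def)
    ultimately show "?R \<le> Max ?S" by simp
  qed
  then show ?thesis by (simp add: max_weight_def)
qed

end
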